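(* Let $a_{ij}$ ($i,j=1,2$), $\mathbf{b}=(b_1,b_2)$ and $c$ be real-valued coefficients on $\mathbb{R}^2$ satisfying the following. (1) $a_{ij}\in C^1(\mathbb{R}^2)$, $a_{ij}=a_{ji}$ for $i,j=1,2$, and there is $\lambda>0$ with $\sum_{i,j=1}^2 a_{ij}(x)\xi_i\xi_j\ge\lambda|\xi|^2$ for all $\xi,x\in\mathbb{R}^2$; moreover, for some $\alpha\in[0,2]$, $|a_{ij}(x)|=O(|x|^{\alpha})$ and $|\partial_i a_{ij}(x)|=O(|x|^{\alpha-1})$ as $|x|\to\infty$ for $i,j=1,2$. (2) $\mathbf{b}\in C^1(\mathbb{R}^2)$ and, for some $\beta\le 1$, $\mathbf{b}(x)=O(|x|^{\beta})$ as $|x|\to\infty$. (3) $c$ is measurable and nonnegative. (4) At least one of the following holds: $\operatorname{div}\mathbf{b}(x)\le 2c(x)$ in $\mathbb{R}^2$; or $|\operatorname{div}\mathbf{b}(x)|=O(|x|^{\beta-1})$ as $|x|\to\infty$. Let $u\in C^2(\mathbb{R}^2)$ be a solution of $$-\sum_{i,j=1}^2\partial_i\big(a_{ij}(x)\partial_j u\big)+\mathbf{b}(x)\cdot\nabla u+c(x)u=0\quad\text{in }\mathbb{R}^2$$ satisfying $u\in L^q(\mathbb{R}^2)$ for some $q\in[2,\infty)$. Then $u\equiv0$ on $\mathbb{R}^2$.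
   Context: Functions are real-valued. $\partial_i=\partial/\partial x_i$ and $\operatorname{div}\mathbf{b}=\partial_1 b_1+\partial_2 b_2$. *)

theory Defs
  imports "HOL-Analysis.Analysis" "HOL-Library.Landau_Symbols"
begin

definition partial_deriv :: "'n::finite \<Rightarrow> (real^'n \<Rightarrow> real) \<Rightarrow> real^'n \<Rightarrow> real" where
  "partial_deriv i f x = deriv (\<lambda>t. f (x + t *\<^sub>R axis i 1)) 0"

lemma partial_deriv_eq:
  assumes "(f has_derivative f') (at x)"
  shows "partial_deriv i f x = f' (axis i 1)"
proof -
  have g: "((\<lambda>t. x + t *\<^sub>R axis i 1) has_derivative (\<lambda>t. t *\<^sub>R axis i 1)) (at (0::real))"
    by (auto intro!: derivative_eq_intros)
  have "((\<lambda>t. f (x + t *\<^sub>R axis i 1)) has_derivative (\<lambda>t. f' (t *\<^sub>R axis i 1))) (at (0::real))"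
    using has_derivative_compose[OF g, of f f'] assms by simp
  moreover have "(\<lambda>t. f' (t *\<^sub>R axis i 1)) = (*) (f' (axis i 1))"
    using has_derivative_bounded_linear[OF assms]
    by (auto simp: linear_scale bounded_linear.linear mult.commute)
  ultimately show ?thesis
    unfolding partial_deriv_def by (intro DERIV_imp_deriv) (simp add: has_field_derivative_def)
qed

definition gradient :: "(real^'n \<Rightarrow> real) \<Rightarrow> real^'n \<Rightarrow> real^'n" where
  "gradient f x = (\<chi> i. partial_deriv i f x)"

definition divergence :: "(real^'n \<Rightarrow> real^'n) \<Rightarrow> real^'n \<Rightarrow> real" where
  "divergence b x = (\<Sum>i\<in>UNIV. partial_deriv i (\<lambda>y. b y $ i) x)"

primrec C_class :: "nat \<Rightarrow> (real^'n \<Rightarrow> real) \<Rightarrow> bool" where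
  "C_class 0 f \<longleftrightarrow> continuous_on UNIV f"
| "C_class (Suc k) f \<longleftrightarrow> (\<forall>x. f differentiable (at x)) \<and> (\<forall>i. C_class k (partial_deriv i f))"

definition in_Lp :: "real \<Rightarrow> (real^'n \<Rightarrow> real) \<Rightarrow> bool" where
  "in_Lp q u \<longleftrightarrow> u \<in> borel_measurable lebesgue \<and> integrable lebesgue (\<lambda>x. \<bar>u x\<bar> powr q)"

end

theory Submission
  imports Defs
begin

text \<open>
The proof combines an energy estimate, a planar Courant-Lebesgue argument and the maximum principle.

Write \<open>g s = \<bar>s\<bar> powr q\<close>. Testing the equation with \<open>\<phi> g'(u)\<close> for a cutoff \<open>\<phi>\<close> at scale \<open>L\<close>
bounds the integral of \<open>\<phi> g''(u) \<bar>\<nabla>u\<bar>\<^sup>2\<close> by that of \<open>g(u)\<close>. The constant does not depend on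
\<open>L\<close>: second derivatives of \<open>\<phi>\<close> decay like \<open>1 / L\<^sup>2\<close> and meet coefficients \<open>a\<close> of at most quadratic
growth, first derivatives decay like \<open>1 / L\<close> and meet \<open>b\<close> and the derivatives of \<open>a\<close>, of at most
linear growth. Either alternative for the divergence of the drift gives \<open>div b \<le> K + 2 c\<close> for a constant
\<open>K\<close>; the part \<open>2 c\<close> is absorbed by the zeroth order term because \<open>s g'(s) \<ge> 2 g(s)\<close>, and \<open>K\<close> costs
another multiple of the integral of \<open>g(u)\<close>. Hence \<open>\<Psi> = g(u) + g''(u) \<bar>\<nabla>u\<bar>\<^sup>2\<close> has a finite
integral over the plane (\<open>energy_estimate\<close>).

In the plane this gives pointwise decay. Among the squares of half side between \<open>R\<close> and \<open>2 R\<close>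
there is one on whose sides \<open>\<Psi>\<close> integrates to \<open>O(1/R)\<close>. Both \<open>g(u)\<close> and \<open>\<bar>\<nabla>(g(u))\<bar>\<close> are at most
\<open>\<Psi>\<close>, so \<open>g(u) = O(1/R)\<close> uniformly on the boundary of this square
(\<open>small_on_boundary_of_a_square\<close>). Since \<open>c \<ge> 0\<close>, the maximum principle
(\<open>maximum_principle_divergence_form\<close>) carries the bound to the interior, and letting \<open>R\<close> tend to
infinity gives \<open>u = 0\<close> everywhere.
\<close>

section \<open>Partial derivatives and the classes of differentiable functions\<close>

text \<open>Both the fundamental theorem of calculus on coordinate lines and the second derivative test on
arbitrary lines start from this form of the chain rule.\<close>

lemma directional_derivative:
  fixes f :: "real^'n \<Rightarrow> real"
  assumes "f differentiable at (p + t *\<^sub>R v)"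
  shows "((\<lambda>s. f (p + s *\<^sub>R v)) has_real_derivative
           (\<Sum>i\<in>UNIV. v $ i * partial_deriv i f (p + t *\<^sub>R v))) (at t)"
proof -
  obtain f' where f': "(f has_derivative f') (at (p + t *\<^sub>R v))"
    using assms by (auto simp: differentiable_def)
  have lin: "linear f'"
    using f' has_derivative_linear by blast
  have g: "((\<lambda>s. p + s *\<^sub>R v) has_derivative (\<lambda>s. s *\<^sub>R v)) (at t)"
    by (auto intro!: derivative_eq_intros)
  have "f' v = f' (\<Sum>i\<in>UNIV. v $ i *\<^sub>R axis i 1)"
    by (simp add: basis_expansion flip: scalar_mult_eq_scaleR)
  also have "\<dots> = (\<Sum>i\<in>UNIV. v $ i * partial_deriv i f (p + t *\<^sub>R v))"
    by (simp add: linear_sum[OF lin] linear_cmul[OF lin] partial_deriv_eq[OF f'])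
  finally have "(\<lambda>s. f' (s *\<^sub>R v)) =
      (*) (\<Sum>i\<in>UNIV. v $ i * partial_deriv i f (p + t *\<^sub>R v))"
    by (simp add: fun_eq_iff linear_cmul[OF lin] mult.commute)
  then show ?thesis
    using has_derivative_compose[OF g f'] by (simp add: has_field_derivative_def)
qed

lemma partial_deriv_add:
  assumes "f differentiable at x" "g differentiable at x"
  shows "partial_deriv i (\<lambda>x. f x + g x) x = partial_deriv i f x + partial_deriv i g x"
proof -
  obtain f' g' where *: "(f has_derivative f') (at x)" "(g has_derivative g') (at x)"
    using assms by (auto simp: differentiable_def)
  show ?thesis
    using partial_deriv_eq[OF has_derivative_add[OF *]] by (simp add: *[THEN partial_deriv_eq])
qed

lemma partial_deriv_diff:
  assumes "f differentiable at x" "g differentiable at x"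
  shows "partial_deriv i (\<lambda>x. f x - g x) x = partial_deriv i f x - partial_deriv i g x"
proof -
  obtain f' g' where *: "(f has_derivative f') (at x)" "(g has_derivative g') (at x)"
    using assms by (auto simp: differentiable_def)
  show ?thesis
    using partial_deriv_eq[OF has_derivative_diff[OF *]] by (simp add: *[THEN partial_deriv_eq])
qed

lemma partial_deriv_mult:
  assumes "f differentiable at x" "g differentiable at x"
  shows "partial_deriv i (\<lambda>x. f x * g x) x = partial_deriv i f x * g x + f x * partial_deriv i g x"
proof -
  obtain f' g' where *: "(f has_derivative f') (at x)" "(g has_derivative g') (at x)"
    using assms by (auto simp: differentiable_def)
  show ?thesis
    using partial_deriv_eq[OF has_derivative_mult[OF *]] by (simp add: *[THEN partial_deriv_eq])
qed

lemma partial_deriv_compose: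
  assumes "(h has_real_derivative h') (at (f x))" "f differentiable at x"
  shows "partial_deriv i (\<lambda>x. h (f x)) x = h' * partial_deriv i f x"
proof -
  obtain f' where f': "(f has_derivative f') (at x)"
    using assms by (auto simp: differentiable_def)
  have h: "(h has_derivative (*) h') (at (f x))"
    using assms(1) by (simp add: has_field_derivative_def)
  show ?thesis
    using partial_deriv_eq[OF has_derivative_compose[OF f' h]] by (simp add: partial_deriv_eq[OF f'])
qed

lemma partial_deriv_uminus:
  assumes "f differentiable at x"
  shows "partial_deriv i (\<lambda>x. - f x) x = - partial_deriv i f x"
proof -
  have "((\<lambda>s::real. - s) has_real_derivative -1) (at (f x))"
    by (auto intro!: derivative_eq_intros)
  from partial_deriv_compose[OF this assms] show ?thesis by simp
qed

lemma partial_deriv_nth: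
  "partial_deriv i (\<lambda>x::real^'n. x $ j) x = (if i = j then 1 else 0)"
proof -
  have "((\<lambda>x::real^'n. x $ j) has_derivative (\<lambda>x. x $ j)) (at x)"
    by (rule bounded_linear_imp_has_derivative) (rule bounded_linear_vec_nth)
  from partial_deriv_eq[OF this] show ?thesis
    by (simp add: axis_def)
qed

lemma differentiable_nth: "(\<lambda>x::real^'n. x $ j) differentiable at x"
  by (rule bounded_linear_imp_differentiable) (rule bounded_linear_vec_nth)

lemma C_class_1_iff:
  "C_class 1 f \<longleftrightarrow>
     (\<forall>x. f differentiable at x) \<and> (\<forall>i. continuous_on UNIV (partial_deriv i f))"
  by simp

lemma C_class_2_iff:
  "C_class 2 f \<longleftrightarrow> (\<forall>x. f differentiable at x) \<and> (\<forall>i. C_class 1 (partial_deriv i f))"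
  by (simp add: numeral_2_eq_2)

lemma C_class_1_continuous: "C_class 1 f \<Longrightarrow> continuous_on S f"
  by (simp add: differentiable_imp_continuous_within continuous_at_imp_continuous_on)


lemma partial_deriv_const: "partial_deriv i (\<lambda>x. k) x = 0"
  by (simp add: partial_deriv_def)

lemma partial_deriv_cmult:
  "f differentiable at x \<Longrightarrow> partial_deriv i (\<lambda>x. k * f x) x = k * partial_deriv i f x"
  by (simp add: partial_deriv_mult partial_deriv_const)

text \<open>Exhibiting the partial derivatives in closed form reduces membership in \<open>C_class 1\<close> to continuity
of an explicit expression; the closure properties below are all obtained in this way.\<close>

lemma C_class_1I:
  assumes "\<And>x. f differentiable at x" "\<And>i x. partial_deriv i f x = d i x"
    and "\<And>i. continuous_on UNIV (d i)"
  shows "C_class 1 f"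
proof -
  have "partial_deriv i f = d i" for i
    using assms(2) by blast
  with assms show ?thesis
    by (simp add: C_class_1_iff del: One_nat_def)
qed

lemma C_class_1D:
  assumes "C_class 1 f"
  shows "f differentiable at x" "continuous_on S (partial_deriv i f)" "continuous_on S f"
  using assms continuous_on_subset[of UNIV "partial_deriv i f" S]
  by (auto simp: C_class_1_iff simp del: One_nat_def C_class.simps
      intro: C_class_1_continuous[OF assms])

lemma C_class_1_const: "C_class 1 (\<lambda>x. k)"
  by (rule C_class_1I[where d = "\<lambda>i x. 0"]) (simp_all add: partial_deriv_const)

lemma C_class_1_nth: "C_class 1 (\<lambda>x::real^'n. x $ j)"
  by (rule C_class_1I[OF _ partial_deriv_nth]) (simp_all add: differentiable_nth)

lemma C_class_1_add:
  assumes "C_class 1 f" "C_class 1 g"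
  shows "C_class 1 (\<lambda>x. f x + g x)"
  by (rule C_class_1I[OF _ partial_deriv_add])
    (intro derivative_intros continuous_intros C_class_1D(1,2) assms)+

lemma C_class_1_diff:
  assumes "C_class 1 f" "C_class 1 g"
  shows "C_class 1 (\<lambda>x. f x - g x)"
  by (rule C_class_1I[OF _ partial_deriv_diff])
    (intro derivative_intros continuous_intros C_class_1D(1,2) assms)+

lemma C_class_1_mult:
  assumes "C_class 1 f" "C_class 1 g"
  shows "C_class 1 (\<lambda>x. f x * g x)"
  by (rule C_class_1I[OF _ partial_deriv_mult])
    (intro derivative_intros continuous_intros C_class_1D(1,2) C_class_1D(3)[OF assms(1)] C_class_1D(3)[OF assms(2)] assms)+

lemma C_class_1_sum:
  assumes "\<And>j. j \<in> J \<Longrightarrow> C_class 1 (f j)"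
  shows "C_class 1 (\<lambda>x. \<Sum>j\<in>J. f j x)"
  using assms
  by (induction J rule: infinite_finite_induct)
    (simp_all add: C_class_1_const C_class_1_add del: C_class.simps One_nat_def)

lemma partial_deriv_sum:
  assumes "finite J" "\<And>j. j \<in> J \<Longrightarrow> f j differentiable at x"
  shows "partial_deriv i (\<lambda>x. \<Sum>j\<in>J. f j x) x = (\<Sum>j\<in>J. partial_deriv i (f j) x)"
  using assms by (induction J) (simp_all add: partial_deriv_const partial_deriv_add differentiable_sum)

lemma C_class_1_compose:
  assumes h: "\<And>s. (h has_real_derivative h' s) (at s)" and h': "continuous_on UNIV h'"
    and f: "C_class 1 f"
  shows "C_class 1 (\<lambda>x. h (f x))"
proof (rule C_class_1I)
  show "(\<lambda>x. h (f x)) differentiable at x" for x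
    using h C_class_1D(1)[OF f] has_derivative_compose
    unfolding has_field_derivative_def differentiable_def by blast
  show "partial_deriv i (\<lambda>x. h (f x)) x = h' (f x) * partial_deriv i f x" for i x
    by (rule partial_deriv_compose[OF h C_class_1D(1)[OF f]])
  show "continuous_on UNIV (\<lambda>x. h' (f x) * partial_deriv i f x)" for i
    by (intro continuous_intros continuous_on_compose2[OF h'] C_class_1D f) auto
qed

lemma C_class_2_uminus:
  assumes u: "C_class 2 u"
  shows "C_class 2 (\<lambda>x. - u x)"
    and "partial_deriv j (\<lambda>x. - u x) = (\<lambda>x. - partial_deriv j u x)"
    and "partial_deriv i (partial_deriv j (\<lambda>x. - u x)) = (\<lambda>x. - partial_deriv i (partial_deriv j u) x)"
proof -
  have d: "u differentiable at x" "C_class 1 (partial_deriv j u)" for x j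
    using u by (auto simp: C_class_2_iff)
  have e: "partial_deriv j (\<lambda>x. - u x) = (\<lambda>x. - partial_deriv j u x)" for j
    using partial_deriv_uminus[OF d(1)] by blast
  then show "partial_deriv j (\<lambda>x. - u x) = (\<lambda>x. - partial_deriv j u x)" .
  show "partial_deriv i (partial_deriv j (\<lambda>x. - u x)) = (\<lambda>x. - partial_deriv i (partial_deriv j u) x)"
    unfolding e using partial_deriv_uminus[OF C_class_1D(1)[OF d(2)]] by blast
  have "C_class 1 (\<lambda>x. 0 - partial_deriv j u x)" for j
    by (intro C_class_1_diff C_class_1_const d)
  then show "C_class 2 (\<lambda>x. - u x)"
    using d(1) by (auto simp: C_class_2_iff e intro: differentiable_minus simp del: One_nat_def C_class.simps)
qed

section \<open>Integrals over squares\<close>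

lemma vector_2_conv_axis: "(vector [x, y] :: real^2) = x *\<^sub>R axis 1 1 + y *\<^sub>R axis 2 1"
  by (simp add: vec_eq_iff forall_2 axis_def)

lemma continuous_on_vector_2 [continuous_intros]:
  fixes f g :: "'a::topological_space \<Rightarrow> real"
  assumes "continuous_on S f" "continuous_on S g"
  shows "continuous_on S (\<lambda>p. vector [f p, g p] :: real^2)"
  unfolding vector_2_conv_axis by (intro continuous_intros assms)

lemma has_real_derivative_along_axes:
  fixes f :: "real^2 \<Rightarrow> real"
  assumes "f differentiable at (vector [x, y])"
  shows "((\<lambda>s. f (vector [s, y])) has_real_derivative partial_deriv 1 f (vector [x, y])) (at x)"
    and "((\<lambda>s. f (vector [x, s])) has_real_derivative partial_deriv 2 f (vector [x, y])) (at y)"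
proof -
  have 1: "(vector [s, y] :: real^2) = vector [0, y] + s *\<^sub>R axis 1 1" for s :: real
    by (simp add: vector_2_conv_axis)
  have 2: "(vector [x, s] :: real^2) = vector [x, 0] + s *\<^sub>R axis 2 1" for s :: real
    by (simp add: vector_2_conv_axis)
  have ax: "(axis 1 1 :: real^2) $ 2 = 0" "(axis 2 1 :: real^2) $ 1 = 0"
    by (simp_all add: axis_def)
  show "((\<lambda>s. f (vector [s, y])) has_real_derivative partial_deriv 1 f (vector [x, y])) (at x)"
    using directional_derivative[of f "vector [0, y]" x "axis 1 1"] assms
    by (simp add: sum_2 ax flip: 1)
  show "((\<lambda>s. f (vector [x, s])) has_real_derivative partial_deriv 2 f (vector [x, y])) (at y)"
    using directional_derivative[of f "vector [x, 0]" y "axis 2 1"] assms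
    by (simp add: sum_2 ax flip: 2)
qed

text \<open>Every integrand in the energy estimate is continuous, so the gauge integral over a square in
\<open>real \<times> real\<close> suffices; there Fubini's theorem for continuous functions applies directly.\<close>

definition square_integral :: "real \<Rightarrow> (real^2 \<Rightarrow> real) \<Rightarrow> real" where
  "square_integral L f = integral (cbox (-L, -L) (L, L)) (\<lambda>(x, y). f (vector [x, y]))"

lemma continuous_on_pair_vector:
  assumes "continuous_on UNIV f"
  shows "continuous_on S (\<lambda>(x, y). f (vector [x, y] :: real^2) :: real)"
  unfolding case_prod_beta
  by (intro continuous_intros continuous_on_compose2[OF assms]) auto

lemma square_integrable:
  assumes "continuous_on UNIV f"
  shows "(\<lambda>(x, y). f (vector [x, y] :: real^2) :: real) integrable_on cbox a b"
  by (intro integrable_continuous continuous_on_pair_vector assms)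

lemma square_integral_iterated:
  assumes "continuous_on UNIV f"
  shows "square_integral L f = integral {-L..L} (\<lambda>x. integral {-L..L} (\<lambda>y. f (vector [x, y])))"
    and "square_integral L f = integral {-L..L} (\<lambda>y. integral {-L..L} (\<lambda>x. f (vector [x, y])))"
    and "(\<lambda>x. integral {-L..L} (\<lambda>y. f (vector [x, y]))) integrable_on {a..b}"
    and "(\<lambda>y. integral {-L..L} (\<lambda>x. f (vector [x, y]))) integrable_on {a..b}"
proof -
  note c = continuous_on_pair_vector[OF assms]
  have c': "continuous_on S (\<lambda>(y, x). f (vector [x, y]))" for S
    unfolding case_prod_beta
    by (intro continuous_intros continuous_on_compose2[OF assms]) auto
  show 1: "square_integral L f = integral {-L..L} (\<lambda>x. integral {-L..L} (\<lambda>y. f (vector [x, y])))"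
    using integral_prod_continuous[OF c, of "-L" "-L" L L]
    by (simp add: square_integral_def)
  show "square_integral L f = integral {-L..L} (\<lambda>y. integral {-L..L} (\<lambda>x. f (vector [x, y])))"
    unfolding 1 using integral_swap_continuous[of "-L" "-L" L L "\<lambda>x y. f (vector [x, y])"] c by simp
  show "(\<lambda>x. integral {-L..L} (\<lambda>y. f (vector [x, y]))) integrable_on {a..b}"
    using integral_integrable_2dim[OF c, of "-L" L a b] by simp
  show "(\<lambda>y. integral {-L..L} (\<lambda>x. f (vector [x, y]))) integrable_on {a..b}"
    using integral_integrable_2dim[OF c', of "-L" L a b] by simp
qed

lemma square_integral_add:
  assumes "continuous_on UNIV f" "continuous_on UNIV g"
  shows "square_integral L (\<lambda>x. f x + g x) = square_integral L f + square_integral L g"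
  using integral_add[OF square_integrable[OF assms(1)] square_integrable[OF assms(2)]]
  unfolding square_integral_def case_prod_beta .

lemma square_integral_cmult:
  "square_integral L (\<lambda>x. k * f x) = k * square_integral L f"
  unfolding square_integral_def case_prod_beta by (rule integral_mult_right)

lemma square_integral_mono:
  assumes "continuous_on UNIV f" "continuous_on UNIV g"
    and "\<And>x. \<bar>x $ 1\<bar> \<le> L \<Longrightarrow> \<bar>x $ 2\<bar> \<le> L \<Longrightarrow> f x \<le> g x"
  shows "square_integral L f \<le> square_integral L g"
  unfolding square_integral_def
  by (rule integral_le) (use assms square_integrable in \<open>auto simp: cbox_Pair_iff\<close>)

lemma square_integral_mono_domain:
  assumes "continuous_on UNIV f" "\<And>x. 0 \<le> f x" "L \<le> L'"
  shows "square_integral L f \<le> square_integral L' f"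
  unfolding square_integral_def
  by (rule integral_subset_le) (use assms square_integrable in \<open>auto simp: cbox_Pair_iff\<close>)

lemma square_integral_nonneg:
  assumes "continuous_on UNIV f" "\<And>x. 0 \<le> f x"
  shows "0 \<le> square_integral L f"
  unfolding square_integral_def
  by (rule integral_nonneg) (use assms in \<open>auto intro!: square_integrable\<close>)

text \<open>By Fubini's theorem each \<open>partial_deriv i (F i)\<close> may be integrated first in its own direction, where
the fundamental theorem of calculus leaves the boundary values of \<open>F i\<close>, which vanish.\<close>

lemma square_integral_divergence_eq_0:
  fixes F :: "2 \<Rightarrow> real^2 \<Rightarrow> real"
  assumes F: "\<And>i. C_class 1 (F i)" and L: "0 \<le> L"
    and zero: "\<And>i x. L \<le> \<bar>x $ i\<bar> \<Longrightarrow> F i x = 0"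
  shows "square_integral L (\<lambda>x. \<Sum>i\<in>UNIV. partial_deriv i (F i) x) = 0"
proof -
  note c = C_class_1D(2)[OF F]
  have 1: "integral {-L..L} (\<lambda>x. partial_deriv 1 (F 1) (vector [x, y])) = 0" for y
  proof (rule integral_unique)
    have "((\<lambda>x. partial_deriv 1 (F 1) (vector [x, y])) has_integral
        F 1 (vector [L, y]) - F 1 (vector [-L, y])) {-L..L}"
      using L C_class_1D(1)[OF F]
      by (intro fundamental_theorem_of_calculus)
        (auto simp: has_real_derivative_iff_has_vector_derivative[symmetric]
          intro!: has_field_derivative_at_within has_real_derivative_along_axes(1))
    then show "((\<lambda>x. partial_deriv 1 (F 1) (vector [x, y])) has_integral 0) {-L..L}"
      using L by (simp add: zero)
  qed
  have 2: "integral {-L..L} (\<lambda>y. partial_deriv 2 (F 2) (vector [x, y])) = 0" for x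
  proof (rule integral_unique)
    have "((\<lambda>y. partial_deriv 2 (F 2) (vector [x, y])) has_integral
        F 2 (vector [x, L]) - F 2 (vector [x, -L])) {-L..L}"
      using L C_class_1D(1)[OF F]
      by (intro fundamental_theorem_of_calculus)
        (auto simp: has_real_derivative_iff_has_vector_derivative[symmetric]
          intro!: has_field_derivative_at_within has_real_derivative_along_axes(2))
    then show "((\<lambda>y. partial_deriv 2 (F 2) (vector [x, y])) has_integral 0) {-L..L}"
      using L by (simp add: zero)
  qed
  show ?thesis
    using square_integral_iterated(2)[OF c, of L 1 1] square_integral_iterated(1)[OF c, of L 2 2]
    by (simp add: sum_2 square_integral_add[OF c c] 1 2)
qed

text \<open>The Courant-Lebesgue principle with squares in place of circles. As the half side \<open>r\<close> runs through
\<open>[R, 2R]\<close>, each of the four sides sweeps out a part of the square of half side \<open>2R\<close>, so the integral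
over \<open>r\<close> of the four side integrals is at most \<open>4E\<close>; some \<open>r\<close> lies below the average. Each side is
prolonged to the full segment across the large square, which makes the length of the segments independent
of \<open>r\<close>. The added 1 turns the non-strict comparison of integrals into a contradiction without an
appeal to continuity in \<open>r\<close>.\<close>

lemma exists_square_small_on_sides:
  fixes f :: "real^2 \<Rightarrow> real"
  assumes f: "continuous_on UNIV f" "\<And>x. 0 \<le> f x" and R: "0 < R"
    and E: "square_integral (2 * R) f \<le> E"
  obtains r where "R \<le> r" "r \<le> 2 * R"
    and "\<And>s. \<bar>s\<bar> = r \<Longrightarrow> integral {-2*R..2*R} (\<lambda>y. f (vector [s, y])) \<le> (4 * E + 1) / R"
    and "\<And>s. \<bar>s\<bar> = r \<Longrightarrow> integral {-2*R..2*R} (\<lambda>x. f (vector [x, s])) \<le> (4 * E + 1) / R"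
proof -
  define h1 where "h1 = (\<lambda>x. integral {-2*R..2*R} (\<lambda>y. f (vector [x, y])))"
  define h2 where "h2 = (\<lambda>y. integral {-2*R..2*R} (\<lambda>x. f (vector [x, y])))"
  have c1: "continuous_on S (\<lambda>y. f (vector [x, y]))" for x S
    by (intro continuous_intros continuous_on_compose2[OF f(1)]) auto
  have c2: "continuous_on S (\<lambda>x. f (vector [x, y]))" for y S
    by (intro continuous_intros continuous_on_compose2[OF f(1)]) auto
  have pos: "0 \<le> h1 t" "0 \<le> h2 t" for t
    using f(2) unfolding h1_def h2_def
    by (auto intro!: integral_nonneg integrable_continuous_real c1 c2)
  have int: "h1 integrable_on {s..t}" "h2 integrable_on {s..t}" for s t
    using square_integral_iterated(3,4)[OF f(1), of "2*R" s t] by (simp_all add: h1_def h2_def)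
  have tot: "integral {-2*R..2*R} h1 \<le> E" "integral {-2*R..2*R} h2 \<le> E"
    using E square_integral_iterated(1,2)[OF f(1), of "2*R"] by (simp_all add: h1_def h2_def)
  have half: "integral {R..2*R} h \<le> E \<and> integral {R..2*R} (\<lambda>t. h (- t)) \<le> E
      \<and> (\<lambda>t. h (- t)) integrable_on {R..2*R}"
    if i: "\<And>s t. h integrable_on {s..t}" and h: "integral {-2*R..2*R} h \<le> E" "\<And>t. 0 \<le> h t"
    for h :: "real \<Rightarrow> real"
  proof -
    have "integral {R..2*R} h \<le> integral {-2*R..2*R} h"
      by (rule integral_subset_le) (use i h R in auto)
    moreover have "integral {-2*R..-R} h \<le> integral {-2*R..2*R} h"
      by (rule integral_subset_le) (use i h R in auto)
    moreover have "integral {R..2*R} (\<lambda>t. h (- t)) = integral {-2*R..-R} h"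
      using Henstock_Kurzweil_Integration.integral_reflect_real[where a = "-(2*R)" and b = "-R" and f = h] by simp
    moreover have "(\<lambda>t. h (- t)) integrable_on {R..2*R}"
      using Henstock_Kurzweil_Integration.integrable_reflect_real[where a = "-(2*R)" and b = "-R" and f = h] i[of "-(2*R)" "-R"] by simp
    ultimately show ?thesis using h by simp
  qed
  note half1 = half[OF int(1) tot(1) pos(1)] and half2 = half[OF int(2) tot(2) pos(2)]
  define k where "k = (\<lambda>t. (h1 t + h1 (- t)) + (h2 t + h2 (- t)))"
  have "(k has_integral (integral {R..2*R} h1 + integral {R..2*R} (\<lambda>t. h1 (- t)))
      + (integral {R..2*R} h2 + integral {R..2*R} (\<lambda>t. h2 (- t)))) {R..2*R}"
    unfolding k_def by (intro has_integral_add integrable_integral) (use half1 half2 int in auto)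
  then have k: "k integrable_on {R..2*R}" "integral {R..2*R} k \<le> 4 * E"
    using half1 half2 by (auto simp: has_integral_integrable integral_unique)
  have "\<exists>r\<in>{R..2*R}. k r \<le> (4 * E + 1) / R"
  proof (rule ccontr)
    assume "\<not> ?thesis"
    then have "\<And>t. t \<in> {R..2*R} \<Longrightarrow> (4 * E + 1) / R \<le> k t" by force
    then have "integral {R..2*R} (\<lambda>t. (4 * E + 1) / R) \<le> integral {R..2*R} k"
      by (intro integral_le k) auto
    with k(2) R show False by simp
  qed
  then obtain r where r: "R \<le> r" "r \<le> 2*R" "k r \<le> (4 * E + 1) / R" by auto
  have "h1 s \<le> k r \<and> h2 s \<le> k r" if "\<bar>s\<bar> = r" for s
    using that pos[of r] pos[of "-r"] unfolding k_def by (auto simp: abs_if split: if_splits)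
  then show ?thesis
    using that[of r] r unfolding h1_def h2_def by (meson order_trans)
qed

text \<open>The one-dimensional Sobolev inequality: on a segment of length at least 2 the function must be at most
\<open>\<epsilon>\<close> somewhere, and from there it can grow by no more than the integral of \<open>\<bar>g'\<bar>\<close>.\<close>

lemma sup_bound_from_integral:
  fixes g \<psi> :: "real \<Rightarrow> real"
  assumes L: "1 \<le> L" and \<epsilon>: "0 < \<epsilon>"
    and g: "\<And>t. (g has_real_derivative g' t) (at t)"
    and le: "\<And>t. g t \<le> \<psi> t" "\<And>t. \<bar>g' t\<bar> \<le> \<psi> t"
    and \<psi>: "continuous_on UNIV \<psi>" "integral {-L..L} \<psi> \<le> \<epsilon>"
    and y: "\<bar>y\<bar> \<le> L"
  shows "g y \<le> 2 * \<epsilon>"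
proof -
  have i: "\<psi> integrable_on {s..t}" for s t
    by (intro integrable_continuous_real continuous_on_subset[OF \<psi>(1)]) auto
  have pos: "0 \<le> \<psi> t" for t
    using le(2)[of t] by linarith
  have "\<exists>t\<in>{-L..L}. g t \<le> \<epsilon>"
  proof (rule ccontr)
    assume "\<not> ?thesis"
    then have "\<epsilon> \<le> \<psi> t" if "t \<in> {-L..L}" for t
      using that le(1)[of t] by (meson le_less_trans less_imp_le linorder_not_le order_trans)
    then have "integral {-L..L} (\<lambda>t. \<epsilon>) \<le> integral {-L..L} \<psi>"
      by (intro integral_le i) auto
    then have "2 * L * \<epsilon> \<le> \<epsilon>" using \<psi>(2) L by simp
    then show False using L \<epsilon> by simp
  qed
  then obtain z where "z \<in> {-L..L}" "g z \<le> \<epsilon>" by blast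
  then have z: "\<bar>z\<bar> \<le> L" "g z \<le> \<epsilon>" by auto
  have incr: "\<bar>g t - g s\<bar> \<le> \<epsilon>" if st: "s \<le> t" "-L \<le> s" "t \<le> L" for s t
  proof -
    have h: "(g' has_integral g t - g s) {s..t}"
      using st g by (intro fundamental_theorem_of_calculus)
        (auto simp: has_real_derivative_iff_has_vector_derivative[symmetric]
          intro: has_field_derivative_at_within)
    have "\<bar>integral {s..t} g'\<bar> \<le> integral {s..t} \<psi>"
      using integral_norm_bound_integral[of g' "{s..t}" \<psi>] h i le(2) by (auto simp: has_integral_integrable)
    moreover have "integral {s..t} \<psi> \<le> integral {-L..L} \<psi>"
      using st pos by (intro integral_subset_le i) auto
    ultimately show ?thesis using h \<psi>(2) by (simp add: integral_unique)
  qed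
  have "\<bar>g y - g z\<bar> \<le> \<epsilon>"
    using incr[of y z] incr[of z y] y z by (cases "y \<le> z") (auto simp: abs_minus_commute)
  with z show ?thesis by linarith
qed

section \<open>Comparison with the Lebesgue integral\<close>

text \<open>Identifies Lebesgue measure on \<open>real^2\<close> with the product measure, so that a Lebesgue integral can be
compared with integrals over squares in \<open>real \<times> real\<close>.\<close>

lemma lborel_vector_2: "lborel = distr lborel borel (\<lambda>(x, y). vector [x, y] :: real^2)"
proof (rule lborel_eqI)
  let ?T = "\<lambda>(x, y). vector [x, y] :: real^2"
  have m: "?T \<in> borel_measurable (lborel :: (real \<times> real) measure)"
    by (simp add: case_prod_beta borel_measurable_continuous_onI continuous_intros
        continuous_on_fst continuous_on_snd continuous_on_id)
  fix l u :: "real^2" assume le: "\<And>b. b \<in> Basis \<Longrightarrow> l \<bullet> b \<le> u \<bullet> b"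
  have le': "l $ i \<le> u $ i" for i
    using le[of "axis i 1"] by (simp add: inner_axis axis_in_Basis_iff)
  have "?T -` box l u = box (l $ 1, l $ 2) (u $ 1, u $ 2)"
  proof (intro set_eqI, clarify)
    fix x y :: real
    have "(x, y) \<in> box (l $ 1, l $ 2) (u $ 1, u $ 2) \<longleftrightarrow>
        l $ 1 < x \<and> x < u $ 1 \<and> l $ 2 < y \<and> y < u $ 2"
      by (auto simp: box_def Basis_prod_def)
    then show "(x, y) \<in> ?T -` box l u \<longleftrightarrow> (x, y) \<in> box (l $ 1, l $ 2) (u $ 1, u $ 2)"
      by (auto simp: mem_box_cart forall_2)
  qed
  then have "emeasure (distr lborel borel ?T) (box l u) = emeasure lborel (box (l $ 1, l $ 2) (u $ 1, u $ 2))"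
    using m by (simp add: emeasure_distr)
  also have "\<dots> = ennreal ((u $ 1 - l $ 1) * (u $ 2 - l $ 2))"
    using le' by (subst emeasure_lborel_box) (auto simp: Basis_prod_def)
  also have "(u $ 1 - l $ 1) * (u $ 2 - l $ 2) = (\<Prod>b\<in>Basis. (u - l) \<bullet> b)"
    by (simp add: Basis_vec_def UNIV_2 inner_axis axis_eq_axis)
  finally show "emeasure (distr lborel borel ?T) (box l u) = ennreal (\<Prod>b\<in>Basis. (u - l) \<bullet> b)" .
qed simp

lemma square_integral_le_lebesgue_integral:
  assumes f: "continuous_on UNIV f" "\<And>x. 0 \<le> f x" and int: "integrable lebesgue f"
  shows "square_integral L f \<le> integral\<^sup>L lebesgue f"
proof -
  let ?T = "\<lambda>(x, y). vector [x, y] :: real^2"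
  have m: "?T \<in> borel_measurable (lborel :: (real \<times> real) measure)"
    by (simp add: case_prod_beta borel_measurable_continuous_onI continuous_intros
        continuous_on_fst continuous_on_snd continuous_on_id)
  have fm: "f \<in> borel_measurable borel"
    by (rule borel_measurable_continuous_onI[OF f(1)])
  have intb: "integrable lborel f" and eq: "integral\<^sup>L lebesgue f = integral\<^sup>L lborel f"
    using int fm by (simp_all add: integrable_completion integral_completion)
  have i: "integrable lborel (\<lambda>p. f (?T p))"
    using intb fm m by (subst (asm) lborel_vector_2) (simp add: integrable_distr_eq)
  have e: "integral\<^sup>L lborel f = (\<integral>p. f (?T p) \<partial>lborel)"
    using fm m by (subst lborel_vector_2) (simp add: integral_distr)
  have "((\<lambda>p. f (?T p)) has_integral (\<integral>p. f (?T p) \<partial>lborel)) UNIV"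
    by (rule has_integral_integral_lborel[OF i])
  moreover have "(\<lambda>p. f (?T p)) = (\<lambda>(x, y). f (vector [x, y]))"
    by (simp add: fun_eq_iff)
  ultimately have "square_integral L f \<le> (\<integral>p. f (?T p) \<partial>lborel)"
    unfolding square_integral_def
    by (intro has_integral_subset_le[OF _ integrable_integral[OF square_integrable[OF f(1)]]])
      (use f(2) in auto)
  then show ?thesis by (simp add: eq e)
qed

section \<open>The maximum principle\<close>

text \<open>A positive second derivative would make \<open>g'\<close> positive just to the right of the critical point, and
\<open>g\<close> would increase there.\<close>

lemma second_derivative_nonpos_at_max:
  fixes g :: "real \<Rightarrow> real"
  assumes g: "\<And>t. (g has_real_derivative g' t) (at t)"
    and g': "(g' has_real_derivative D) (at 0)"
    and r: "0 < r" and max: "\<And>t. \<bar>t\<bar> < r \<Longrightarrow> g t \<le> g 0"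
  shows "g' 0 = 0" "D \<le> 0"
proof -
  show g0: "g' 0 = 0"
    using DERIV_local_max[OF g[of 0] r] max by simp
  show "D \<le> 0"
  proof (rule ccontr)
    assume "\<not> D \<le> 0"
    then obtain d where d: "0 < d" "\<And>h. 0 < h \<Longrightarrow> h < d \<Longrightarrow> g' 0 < g' (0 + h)"
      using DERIV_pos_inc_right[OF g'] by force
    define t where "t = min d r / 2"
    have t: "0 < t" "t < d" "t < r"
      using d(1) r by (auto simp: t_def)
    obtain z where z: "0 < z" "z < t" "g t - g 0 = (t - 0) * g' z"
      using MVT2[of 0 t g g'] t(1) g by auto
    then have "0 < g t - g 0"
      using d(2)[of z] t g0 by simp
    with max[of t] t show False by simp
  qed
qed

text \<open>The one-dimensional test on the line through \<open>z\<close> with direction \<open>v\<close>. The second derivative along the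
line exists because the first partial derivatives of \<open>w\<close> are again differentiable.\<close>

lemma hessian_at_max:
  fixes w :: "real^'n \<Rightarrow> real"
  assumes w: "C_class 2 w" and z: "z \<in> interior S" and max: "\<And>y. y \<in> S \<Longrightarrow> w y \<le> w z"
  shows "(\<Sum>i\<in>UNIV. \<Sum>j\<in>UNIV. v $ i * v $ j * partial_deriv i (partial_deriv j w) z) \<le> 0"
    and "partial_deriv i w z = 0"
proof -
  obtain e where e: "0 < e" "ball z e \<subseteq> S"
    using z by (meson mem_interior)
  have key: "(\<Sum>j\<in>UNIV. v $ j * partial_deriv j w z) = 0 \<and>
      (\<Sum>i\<in>UNIV. v $ i * (\<Sum>j\<in>UNIV. v $ j * partial_deriv i (partial_deriv j w) z)) \<le> 0" for v :: "real^'n"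
  proof -
    define g where "g t = w (z + t *\<^sub>R v)" for t
    define g' where "g' t = (\<Sum>j\<in>UNIV. v $ j * partial_deriv j w (z + t *\<^sub>R v))" for t
    define h where "h x = (\<Sum>j\<in>UNIV. v $ j * partial_deriv j w x)" for x
    have g: "(g has_real_derivative g' t) (at t)" for t
      unfolding g_def g'_def by (rule directional_derivative) (use w in \<open>simp add: C_class_2_iff\<close>)
    have dw: "C_class 1 (partial_deriv j w)" for j
      using w by (simp add: C_class_2_iff)
    have h: "C_class 1 h"
      unfolding h_def by (intro C_class_1_sum C_class_1_mult C_class_1_const dw)
    have pd: "partial_deriv i h z = (\<Sum>j\<in>UNIV. v $ j * partial_deriv i (partial_deriv j w) z)" for i
      unfolding h_def
      by (subst partial_deriv_sum) (auto intro!: C_class_1D(1) C_class_1_mult C_class_1_const dw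
          simp: partial_deriv_cmult[OF C_class_1D(1)[OF dw]])
    have "(g' has_real_derivative (\<Sum>i\<in>UNIV. v $ i * partial_deriv i h (z + 0 *\<^sub>R v))) (at 0)"
      unfolding g'_def h_def[symmetric] by (rule directional_derivative) (rule C_class_1D(1)[OF h])
    then have g': "(g' has_real_derivative (\<Sum>i\<in>UNIV. v $ i * (\<Sum>j\<in>UNIV. v $ j * partial_deriv i (partial_deriv j w) z))) (at 0)"
      by (simp add: pd)
    have r: "0 < e / (norm v + 1)"
      using e by (simp add: add_nonneg_pos)
    have "g t \<le> g 0" if t: "\<bar>t\<bar> < e / (norm v + 1)" for t
    proof -
      have "\<bar>t\<bar> * norm v \<le> \<bar>t\<bar> * (norm v + 1)"
        by (simp add: mult_left_mono)
      also have "\<dots> < e"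
        using t by (simp add: pos_less_divide_eq add_nonneg_pos)
      finally have "z + t *\<^sub>R v \<in> ball z e"
        by (simp add: dist_norm)
      with e max show ?thesis by (auto simp: g_def)
    qed
    from second_derivative_nonpos_at_max[OF g g' r this] show ?thesis
      by (simp add: g'_def)
  qed
  from key[of v] show "(\<Sum>i\<in>UNIV. \<Sum>j\<in>UNIV. v $ i * v $ j * partial_deriv i (partial_deriv j w) z) \<le> 0"
    by (simp add: sum_distrib_left mult.assoc)
  from key[of "axis i 1"] show "partial_deriv i w z = 0"
    by (simp add: axis_def if_distrib[of "\<lambda>x. x * _"] cong: if_cong)
qed

text \<open>Completing the square writes \<open>A 1 1\<close> times the matrix \<open>A\<close> as a sum of two rank one matrices
\<open>v v\<^sup>T\<close>, with \<open>v = (A 1 1, A 1 2)\<close> and \<open>v = (0, \<surd>d)\<close> where \<open>d = det A\<close>; each of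
them contributes a value of the quadratic form of \<open>H\<close>.\<close>

lemma trace_nonpos:
  fixes A H :: "2 \<Rightarrow> 2 \<Rightarrow> real"
  assumes A: "A 1 2 = A 2 1" "0 < A 1 1"
      "\<And>\<xi> :: real^2. 0 \<le> (\<Sum>i\<in>UNIV. \<Sum>j\<in>UNIV. A i j * \<xi> $ i * \<xi> $ j)"
    and H: "\<And>v :: real^2. (\<Sum>i\<in>UNIV. \<Sum>j\<in>UNIV. v $ i * v $ j * H i j) \<le> 0"
  shows "(\<Sum>i\<in>UNIV. \<Sum>j\<in>UNIV. A i j * H i j) \<le> 0"
proof -
  define p where "p = A 1 1"
  define s where "s = A 1 2"
  define d where "d = A 2 2 * p - s\<^sup>2"
  have p: "0 < p" using A(2) by (simp add: p_def)
  \<comment> \<open>The vector \<open>(- s, p)\<close> minimises the form of \<open>A\<close> for fixed second entry, and its value is \<open>p * d\<close>.\<close>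
  have "0 \<le> p * d"
    using A(3)[of "vector [- s, p]"] A(1)
    by (simp add: sum_2 p_def s_def d_def power2_eq_square algebra_simps)
  then have d: "0 \<le> d" using p by (simp add: zero_le_mult_iff)
  have 1: "p * p * H 1 1 + p * s * H 1 2 + (s * p * H 2 1 + s * s * H 2 2) \<le> 0"
    using H[of "vector [p, s]"] by (simp add: sum_2)
  have 2: "d * H 2 2 \<le> 0"
    using H[of "vector [0, 1]"] d by (simp add: sum_2 mult_nonneg_nonpos)
  have "p * (\<Sum>i\<in>UNIV. \<Sum>j\<in>UNIV. A i j * H i j) =
      (p * p * H 1 1 + p * s * H 1 2 + (s * p * H 2 1 + s * s * H 2 2)) + d * H 2 2"
    using A(1) by (simp add: sum_2 p_def s_def d_def power2_eq_square algebra_simps)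
  also have "\<dots> \<le> 0" using 1 2 by simp
  finally show ?thesis using p by (simp add: mult_le_0_iff)
qed

text \<open>If \<open>u\<close> exceeded \<open>M\<close> inside, so would the maximum of the perturbation \<open>w = u + \<epsilon> exp (\<gamma> x\<^sub>1)\<close>, and it
would be an interior point with \<open>u > M \<ge> 0\<close>. The Hessian of \<open>w\<close> contracts to something
nonpositive there, while the differential inequality and the exponential, whose second derivative
dominates the drift once \<open>\<gamma>\<close> is large, make it strictly positive. Only points where \<open>u\<close> is positive
matter, which is what lets a nonnegative zeroth order term of arbitrary size be absorbed in the inequality.\<close>

lemma weak_maximum_principle:
  fixes a :: "2 \<Rightarrow> 2 \<Rightarrow> real^2 \<Rightarrow> real" and B :: "2 \<Rightarrow> real^2 \<Rightarrow> real" and u :: "real^2 \<Rightarrow> real"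
  assumes u: "C_class 2 u"
    and a: "\<And>x. a 1 2 x = a 2 1 x" "0 < lam"
      "\<And>x \<xi>. lam * (norm \<xi>)\<^sup>2 \<le> (\<Sum>i\<in>UNIV. \<Sum>j\<in>UNIV. a i j x * \<xi> $ i * \<xi> $ j)"
    and B: "continuous_on UNIV (B 1)"
    and sub: "\<And>x. 0 < u x \<Longrightarrow>
      (\<Sum>i\<in>UNIV. B i x * partial_deriv i u x) \<le> (\<Sum>i\<in>UNIV. \<Sum>j\<in>UNIV. a i j x * partial_deriv i (partial_deriv j u) x)"
    and S: "compact S" and M: "0 \<le> M" "\<And>x. x \<in> frontier S \<Longrightarrow> u x \<le> M"
    and x: "x \<in> S"
  shows "u x \<le> M"
proof (rule ccontr)
  assume ux: "\<not> u x \<le> M"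
  have "bounded (B 1 ` S)"
    using S B by (intro compact_imp_bounded compact_continuous_image continuous_on_subset[OF B]) auto
  then obtain K where K: "\<And>y. y \<in> S \<Longrightarrow> \<bar>B 1 y\<bar> \<le> K"
    by (auto simp: bounded_iff)
  \<comment> \<open>This makes \<open>lam * \<gamma>\<close> larger than the drift coefficient on \<open>S\<close>.\<close>
  define \<gamma> where "\<gamma> = (\<bar>K\<bar> + 1) / lam"
  have \<gamma>: "0 < \<gamma>" using a(2) by (simp add: \<gamma>_def add_nonneg_pos)
  define e where "e y = exp (\<gamma> * y $ 1)" for y :: "real^2"
  have de: "partial_deriv i e = (\<lambda>y. (if i = 1 then \<gamma> else 0) * e y)" for i
  proof
    fix y :: "real^2"
    have "((\<lambda>s. exp (\<gamma> * s)) has_real_derivative \<gamma> * exp (\<gamma> * y $ 1)) (at (y $ 1))"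
      by (auto intro!: derivative_eq_intros)
    from partial_deriv_compose[OF this differentiable_nth]
    show "partial_deriv i e y = (if i = 1 then \<gamma> else 0) * e y"
      by (simp add: e_def[abs_def] partial_deriv_nth)
  qed
  have e1: "C_class 1 e"
    unfolding e_def[abs_def]
    by (rule C_class_1_compose[where h = "\<lambda>s. exp (\<gamma> * s)" and h' = "\<lambda>s. \<gamma> * exp (\<gamma> * s)"])
      (auto intro!: derivative_eq_intros continuous_intros C_class_1_nth simp del: One_nat_def C_class.simps)
  have e_cont: "continuous_on S e" by (rule C_class_1D(3)[OF e1])
  have epos: "0 < e y" for y by (simp add: e_def)
  have "bounded (e ` S)"
    using S e_cont by (intro compact_imp_bounded compact_continuous_image)
  then obtain N where N: "\<And>y. y \<in> S \<Longrightarrow> e y \<le> N"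
    using epos by (auto simp: bounded_iff less_imp_le)
  have Npos: "0 < N" using N[OF x] epos[of x] by linarith
  \<comment> \<open>Half the excess of \<open>u x\<close> over \<open>M\<close>: the perturbation stays too small to move the maximum to the boundary.\<close>
  define \<epsilon> where "\<epsilon> = (u x - M) / (2 * N)"
  have \<epsilon>: "0 < \<epsilon>" using ux Npos by (simp add: \<epsilon>_def)
  have \<epsilon>N: "\<epsilon> * e y < u x - M" if "y \<in> S" for y
  proof -
    have "\<epsilon> * e y \<le> \<epsilon> * N" using N[OF that] \<epsilon> by simp
    also have "\<dots> < u x - M" using ux Npos by (simp add: \<epsilon>_def)
    finally show ?thesis .
  qed
  define w where "w y = u y + \<epsilon> * e y" for y
  have du: "u differentiable at y" "C_class 1 (partial_deriv j u)" for y j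
    using u by (auto simp: C_class_2_iff)
  have dw: "partial_deriv j w = (\<lambda>y. partial_deriv j u y + \<epsilon> * ((if j = 1 then \<gamma> else 0) * e y))" for j
    unfolding w_def[abs_def]
    by (rule ext) (simp add: partial_deriv_add du C_class_1D(1)[OF e1] differentiable_mult partial_deriv_cmult de
        del: mult_eq_0_iff)
  have w2: "C_class 2 w"
    unfolding C_class_2_iff
  proof safe
    show "w differentiable at y" for y
      unfolding w_def[abs_def] by (intro derivative_intros du C_class_1D(1)[OF e1])
    show "C_class 1 (partial_deriv j w)" for j
      unfolding dw by (intro C_class_1_add C_class_1_mult C_class_1_const du e1)
  qed
  have ddw: "partial_deriv i (partial_deriv j w) y = partial_deriv i (partial_deriv j u) y
      + (if i = 1 \<and> j = 1 then \<epsilon> * \<gamma>\<^sup>2 * e y else 0)" for i j y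
    unfolding dw
    by (simp add: partial_deriv_add du C_class_1D(1)[OF e1] C_class_1D(1)[OF du(2)] differentiable_mult partial_deriv_cmult de
        partial_deriv_const power2_eq_square)
  have "continuous_on S w"
    using C_class_1_continuous[of u S] du e_cont unfolding w_def[abs_def]
    by (intro continuous_intros) (simp add: continuous_at_imp_continuous_on differentiable_imp_continuous_within)
  then obtain z where z: "z \<in> S" "\<And>y. y \<in> S \<Longrightarrow> w y \<le> w z"
    using continuous_attains_sup[OF S] x by blast
  have wz: "u x < w z"
    using z(2)[OF x] \<epsilon> epos[of x] by (simp add: w_def) (smt (verit) mult_pos_pos)
  have uz: "M < u z"
    using wz \<epsilon>N[OF z(1)] by (simp add: w_def)
  have zint: "z \<in> interior S"
    using z(1) M(2)[of z] uz by (auto simp: frontier_def closure_closed compact_imp_closed S)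
  have a11: "lam \<le> a 1 1 z"
  proof -
    have "(axis 1 1 :: real^2) $ 2 = 0" by (simp add: axis_def)
    then show ?thesis
      using a(3)[where x = z and \<xi> = "axis 1 1"] by (simp add: sum_2)
  qed
  have "(\<Sum>i\<in>UNIV. \<Sum>j\<in>UNIV. a i j z * partial_deriv i (partial_deriv j w) z) \<le> 0"
  proof (rule trace_nonpos)
    show "a 1 2 z = a 2 1 z" "0 < a 1 1 z" using a a11 by auto
    show "0 \<le> (\<Sum>i\<in>UNIV. \<Sum>j\<in>UNIV. a i j z * \<xi> $ i * \<xi> $ j)" for \<xi>
      using a(3)[where x = z and \<xi> = \<xi>] a(2) by (smt (verit) mult_nonneg_nonneg zero_le_power2)
  qed (rule hessian_at_max(1)[OF w2 zint z(2)])
  then have "(\<Sum>i\<in>UNIV. \<Sum>j\<in>UNIV. a i j z * partial_deriv i (partial_deriv j u) z) + a 1 1 z * (\<epsilon> * \<gamma>\<^sup>2 * e z) \<le> 0"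
    by (simp add: ddw sum_2 algebra_simps)
  moreover have "partial_deriv 1 u z = - (\<epsilon> * (\<gamma> * e z))" "partial_deriv 2 u z = 0"
    using hessian_at_max(2)[OF w2 zint z(2), of 1] hessian_at_max(2)[OF w2 zint z(2), of 2]
    by (simp_all add: dw)
  ultimately have "- B 1 z * (\<epsilon> * (\<gamma> * e z)) + a 1 1 z * (\<epsilon> * \<gamma>\<^sup>2 * e z) \<le> 0"
    using sub[of z] uz M(1) by (simp add: sum_2)
  then have "(\<epsilon> * \<gamma> * e z) * (a 1 1 z * \<gamma> - B 1 z) \<le> 0"
    by (simp add: power2_eq_square algebra_simps)
  moreover have "0 < \<epsilon> * \<gamma> * e z" using \<epsilon> \<gamma> epos by simp
  ultimately have "a 1 1 z * \<gamma> \<le> B 1 z"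
    by (metis diff_le_0_iff_le mult_pos_pos not_le)
  moreover have "lam * \<gamma> \<le> a 1 1 z * \<gamma>" using a11 \<gamma> by simp
  moreover have "lam * \<gamma> = \<bar>K\<bar> + 1" using a(2) by (simp add: \<gamma>_def)
  ultimately show False using K[OF z(1)] by linarith
qed

text \<open>Expanding the derivatives turns the equation into non-divergence form with drift
\<open>b\<^sub>j - \<Sum>i. \<partial>\<^sub>i a\<^sub>i\<^sub>j\<close> and zeroth order term \<open>c u\<close>. Since \<open>c \<ge> 0\<close>, the one-sided principle
applies both to \<open>u\<close> and to \<open>- u\<close>.\<close>

lemma maximum_principle_divergence_form:
  fixes a :: "2 \<Rightarrow> 2 \<Rightarrow> real^2 \<Rightarrow> real" and b :: "real^2 \<Rightarrow> real^2" and c u :: "real^2 \<Rightarrow> real"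
  assumes a: "\<And>i j. C_class 1 (a i j)" "\<And>i j. a i j = a j i" and lam: "0 < lam"
    and ell: "\<And>x \<xi>. (\<Sum>i\<in>UNIV. \<Sum>j\<in>UNIV. a i j x * \<xi> $ i * \<xi> $ j) \<ge> lam * (norm \<xi>)\<^sup>2"
    and b: "\<And>i. C_class 1 (\<lambda>x. b x $ i)" and c: "\<And>x. 0 \<le> c x"
    and u: "C_class 2 u"
    and eq: "\<And>x. - (\<Sum>i\<in>UNIV. \<Sum>j\<in>UNIV. partial_deriv i (\<lambda>y. a i j y * partial_deriv j u y) x)
             + b x \<bullet> gradient u x + c x * u x = 0"
    and S: "compact S" and M: "0 \<le> M" "\<And>x. x \<in> frontier S \<Longrightarrow> \<bar>u x\<bar> \<le> M"
    and x: "x \<in> S"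
  shows "\<bar>u x\<bar> \<le> M"
proof -
  define B where "B j x = b x $ j - (\<Sum>i\<in>UNIV. partial_deriv i (a i j) x)" for j x
  have Bc: "continuous_on UNIV (B j)" for j
    unfolding B_def[abs_def] by (intro continuous_intros C_class_1D(3)[OF b] C_class_1D(2)[OF a(1)])
  have u1: "partial_deriv j u differentiable at x" for j x
    using u C_class_1D(1) by (auto simp: C_class_2_iff simp del: One_nat_def C_class.simps)
  have eq': "(\<Sum>i\<in>UNIV. \<Sum>j\<in>UNIV. a i j x * partial_deriv i (partial_deriv j u) x)
      = (\<Sum>i\<in>UNIV. B i x * partial_deriv i u x) + c x * u x" for x
    using eq[of x] a(2)[of 1 2]
    unfolding partial_deriv_mult[OF C_class_1D(1)[OF a(1)] u1]
    by (simp add: sum_2 B_def inner_vec_def gradient_def algebra_simps)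
  have sym: "a 1 2 x = a 2 1 x" for x using a(2)[of 1 2] by simp
  have "u x \<le> M"
  proof (rule weak_maximum_principle[OF u sym lam ell Bc _ S M(1) _ x])
    fix y assume "0 < u y"
    then show "(\<Sum>i\<in>UNIV. B i y * partial_deriv i u y)
        \<le> (\<Sum>i\<in>UNIV. \<Sum>j\<in>UNIV. a i j y * partial_deriv i (partial_deriv j u) y)"
      unfolding eq' using c[of y] by simp
  qed (use M(2) in force)
  moreover have "- u x \<le> M"
  proof (rule weak_maximum_principle[OF C_class_2_uminus(1)[OF u] sym lam ell Bc _ S M(1) _ x])
    fix y assume "0 < - u y"
    then have "c y * u y \<le> 0" using c[of y] by (simp add: mult_nonneg_nonpos)
    then show "(\<Sum>i\<in>UNIV. B i y * partial_deriv i (\<lambda>x. - u x) y)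
        \<le> (\<Sum>i\<in>UNIV. \<Sum>j\<in>UNIV. a i j y * partial_deriv i (partial_deriv j (\<lambda>x. - u x)) y)"
      using eq'[of y]
      unfolding C_class_2_uminus(3)[OF u] unfolding C_class_2_uminus(2)[OF u]
      by (simp add: sum_negf)
  qed (use M(2) in force)
  ultimately show ?thesis by simp
qed

section \<open>The nonlinearity and the cutoff\<close>

text \<open>The origin needs a separate argument, because \<open>powr\<close> is defined through the logarithm.\<close>

lemma has_real_derivative_signed_powr:
  fixes p :: real
  assumes p: "0 < p"
  shows "((\<lambda>s. s * \<bar>s\<bar> powr p) has_real_derivative (p + 1) * \<bar>s\<bar> powr p) (at s)"
proof -
  consider "0 < s" | "s < 0" | "s = 0" by linarith
  then show ?thesis
  proof cases
    case 1
    have "((\<lambda>s. s * s powr p) has_real_derivative (p + 1) * \<bar>s\<bar> powr p) (at s)"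
      using 1 by (auto intro!: derivative_eq_intros simp: powr_diff field_simps)
    then show ?thesis
      by (rule has_field_derivative_transform_within_open[where S = "{0<..}"]) (use 1 in auto)
  next
    case 2
    have "((\<lambda>s. s * (- s) powr p) has_real_derivative (p + 1) * \<bar>s\<bar> powr p) (at s)"
      using 2 by (auto intro!: derivative_eq_intros simp: powr_diff field_simps)
    then show ?thesis
      by (rule has_field_derivative_transform_within_open[where S = "{..<0}"]) (use 2 in auto)
  next
    case 3
    have "((\<lambda>h. \<bar>h\<bar> powr p) \<longlongrightarrow> \<bar>0\<bar> powr p) (at (0::real))"
      using p by (intro tendsto_powr' tendsto_intros) auto
    then have "((\<lambda>h. h * \<bar>h\<bar> powr p / h) \<longlongrightarrow> 0) (at (0::real))"
      by (subst tendsto_cong[where g = "\<lambda>h. \<bar>h\<bar> powr p"])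
        (auto simp: eventually_at_filter p)
    then show ?thesis
      using 3 by (simp add: DERIV_def p)
  qed
qed

text \<open>The nonlinearity \<open>g s = \<bar>s\<bar> powr q\<close> enters the energy method through these properties. The inequality
\<open>2 g \<le> s g'\<close> is where \<open>q \<ge> 2\<close> meets the factor 2 in \<open>div b \<le> 2 c\<close>, and \<open>g'\<^sup>2 \<le> 2 g g''\<close> makes
\<open>\<bar>\<nabla>(g \<circ> u)\<bar>\<close> controllable by \<open>g(u)\<close> and \<open>g''(u) \<bar>\<nabla>u\<bar>\<^sup>2\<close>.\<close>

lemma abs_powr_derivatives:
  fixes q :: real
  assumes q: "2 \<le> q"
  obtains g' g'' where
    "\<And>s. ((\<lambda>s. \<bar>s\<bar> powr q) has_real_derivative g' s) (at s)"
    "\<And>s. (g' has_real_derivative g'' s) (at s)"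
    "continuous_on UNIV g''" "\<And>s. 0 \<le> g'' s"
    "\<And>s. 2 * \<bar>s\<bar> powr q \<le> g' s * s"
    "\<And>s. (g' s)\<^sup>2 \<le> 2 * \<bar>s\<bar> powr q * g'' s"
proof -
  \<comment> \<open>The second derivative up to the factor \<open>q (q - 1)\<close>. The case \<open>q = 2\<close> is separate since \<open>0 powr 0 = 0\<close>, which would make it discontinuous.\<close>
  define m where "m s = (if q = 2 then 1 else \<bar>s\<bar> powr (q - 2))" for s :: real
  have m: "((\<lambda>s. s * m s) has_real_derivative (q - 1) * m s) (at s)" for s
    using has_real_derivative_signed_powr[of "q - 2" s] q by (cases "q = 2") (auto simp: m_def[abs_def])
  have m0: "0 \<le> m s" for s by (simp add: m_def)
  have e: "\<bar>s\<bar> powr q = s * (s * m s)" for s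
  proof (cases "s = 0")
    case False
    have "\<bar>s\<bar> powr (2 + (q - 2)) = \<bar>s\<bar> powr 2 * \<bar>s\<bar> powr (q - 2)"
      by (rule powr_add)
    with False show ?thesis by (auto simp: m_def power2_eq_square)
  qed simp
  have "continuous_on UNIV m"
  proof (cases "q = 2")
    case False
    with q show ?thesis
      by (simp add: m_def[abs_def]) (intro continuous_on_powr' continuous_intros; auto)
  qed (simp add: m_def[abs_def])
  show thesis
  proof (rule that[of "\<lambda>s. q * (s * m s)" "\<lambda>s. q * ((q - 1) * m s)"])
    fix s
    have "((\<lambda>s. s * (s * m s)) has_real_derivative 1 * (s * m s) + (q - 1) * m s * s) (at s)"
      by (rule DERIV_mult[OF DERIV_ident m])
    moreover have "1 * (s * m s) + (q - 1) * m s * s = q * (s * m s)"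
      by (simp add: algebra_simps)
    ultimately show "((\<lambda>s. \<bar>s\<bar> powr q) has_real_derivative q * (s * m s)) (at s)"
      by (simp add: e)
    show "((\<lambda>s. q * (s * m s)) has_real_derivative q * ((q - 1) * m s)) (at s)"
      by (rule DERIV_cmult[OF m])
    show "continuous_on UNIV (\<lambda>s. q * ((q - 1) * m s))"
      by (intro continuous_intros) fact
    show "0 \<le> q * ((q - 1) * m s)" using q m0 by simp
    have s0: "0 \<le> s * (s * m s)"
      using m0[of s] by (simp flip: mult.assoc)
    show "2 * \<bar>s\<bar> powr q \<le> q * (s * m s) * s"
      using mult_right_mono[OF q s0] by (simp add: e algebra_simps)
    have "q * (q * ((s * m s) * (s * m s))) \<le> q * (2 * (q - 1) * ((s * m s) * (s * m s)))"
      using q by (intro mult_left_mono mult_right_mono) auto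
    then show "(q * (s * m s))\<^sup>2 \<le> 2 * \<bar>s\<bar> powr q * (q * ((q - 1) * m s))"
      by (simp add: e power2_eq_square algebra_simps)
  qed
qed

lemma has_real_derivative_positive_part_powers:
  fixes s :: real
  shows "((\<lambda>s. (max 0 s)\<^sup>2) has_real_derivative 2 * max 0 s) (at s)"
    and "((\<lambda>s. (max 0 s) ^ 3) has_real_derivative 3 * (max 0 s)\<^sup>2) (at s)"
proof -
  have "((\<lambda>s. s * \<bar>s\<bar> powr 1) has_real_derivative 2 * \<bar>s\<bar>) (at s)"
    using has_real_derivative_signed_powr[of 1 s] by simp
  then have "((\<lambda>s. (s * s + s * \<bar>s\<bar> powr 1) * (1 / 2)) has_real_derivative
      (1 * s + 1 * s + 2 * \<bar>s\<bar>) * (1 / 2)) (at s)"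
    by (intro DERIV_cmult_right DERIV_add DERIV_mult DERIV_ident)
  then have "((\<lambda>s. (s * s + s * \<bar>s\<bar> powr 1) / 2) has_real_derivative 2 * max 0 s) (at s)"
    by (simp add: max_def abs_if split: if_splits)
  moreover have "(\<lambda>s::real. (s * s + s * \<bar>s\<bar> powr 1) / 2) = (\<lambda>s. (max 0 s)\<^sup>2)"
    by (auto simp: fun_eq_iff max_def power2_eq_square)
  ultimately show 1: "((\<lambda>s. (max 0 s)\<^sup>2) has_real_derivative 2 * max 0 s) (at s)"
    by simp
  have "((\<lambda>s. s * (max 0 s)\<^sup>2) has_real_derivative 3 * (max 0 s)\<^sup>2) (at s)"
    by (rule derivative_eq_intros 1 refl)+ (auto simp: max_def power2_eq_square)
  moreover have "(\<lambda>s::real. s * (max 0 s)\<^sup>2) = (\<lambda>s. (max 0 s) ^ 3)"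
    by (auto simp: fun_eq_iff max_def power2_eq_square power3_eq_cube)
  ultimately show "((\<lambda>s. (max 0 s) ^ 3) has_real_derivative 3 * (max 0 s)\<^sup>2) (at s)"
    by simp
qed

text \<open>The third power makes the positive part twice continuously differentiable. A positive lower bound on a smaller ball
takes the place of the usual plateau, so the positive part of a polynomial in the norm is good enough.\<close>

definition cutoff :: "real \<Rightarrow> real^'n \<Rightarrow> real" where
  "cutoff S x = (max 0 (1 - (norm x)\<^sup>2 / S)) ^ 3"

lemma cutoff_bounds: "0 < S \<Longrightarrow> 0 \<le> cutoff S x" "0 < S \<Longrightarrow> cutoff S x \<le> 1"
  by (auto simp: cutoff_def intro!: power_le_one)

lemma cutoff_derivatives:
  fixes x :: "real^'n"
  assumes S: "0 < S"
  defines "p \<equiv> \<lambda>x::real^'n. max 0 (1 - (norm x)\<^sup>2 / S)"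
  shows "partial_deriv i (cutoff S) x = - (6 / S) * (x $ i * (p x)\<^sup>2)"
    and "partial_deriv i (partial_deriv j (cutoff S)) x =
      - (6 / S) * ((if i = j then (p x)\<^sup>2 else 0) - 4 / S * (x $ i * x $ j * p x))"
    and "C_class 2 (cutoff S :: real^'n \<Rightarrow> real)"
proof -
  define r where "r x = 1 - (norm x)\<^sup>2 / S" for x :: "real^'n"
  have S0: "S \<noteq> 0" using S by simp
  have r': "(r has_derivative (\<lambda>h. - (2 * (x \<bullet> h)) / S)) (at x)" for x
    unfolding r_def[abs_def] power2_norm_eq_inner
    by (auto intro!: derivative_eq_intros simp: inner_commute S0)
  have dr: "partial_deriv i r x = - (2 / S) * x $ i" for i x
    using partial_deriv_eq[OF r'] by (simp add: inner_axis)
  have r1: "C_class 1 r"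
  proof (rule C_class_1I[OF _ dr])
    show "r differentiable at x" for x using r' by (auto simp: differentiable_def)
    show "continuous_on UNIV (\<lambda>x::real^'n. - (2 / S) * x $ i)" for i
      by (intro continuous_intros)
  qed
  note rd = C_class_1D(1)[OF r1] and d3 = has_real_derivative_positive_part_powers(2)
    and d2 = has_real_derivative_positive_part_powers(1)
  have c: "cutoff S = (\<lambda>x. (max 0 (r x)) ^ 3)" and p: "p = (\<lambda>x. max 0 (r x))"
    by (simp_all add: fun_eq_iff cutoff_def p_def r_def)
  have dc: "partial_deriv i (cutoff S) x = - (6 / S) * (x $ i * (p x)\<^sup>2)" for i x
    using partial_deriv_compose[OF d3 rd] by (simp add: c p dr)
  then show "partial_deriv i (cutoff S) x = - (6 / S) * (x $ i * (p x)\<^sup>2)" .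
  have dc': "partial_deriv i (cutoff S) = (\<lambda>x. - (6 / S) * (x $ i * (p x)\<^sup>2))" for i
    using dc by blast
  have p2: "C_class 1 (\<lambda>x. (p x)\<^sup>2)"
    unfolding p by (rule C_class_1_compose[OF d2 _ r1]) (intro continuous_intros)
  have dp2: "partial_deriv i (\<lambda>x. (p x)\<^sup>2) x = - (4 / S) * (x $ i * p x)" for i x
    using partial_deriv_compose[OF d2 rd] by (simp add: p dr)
  have xp: "C_class 1 (\<lambda>x. x $ i * (p x)\<^sup>2)" for i
    by (intro C_class_1_mult C_class_1_nth p2)
  show "partial_deriv i (partial_deriv j (cutoff S)) x =
      - (6 / S) * ((if i = j then (p x)\<^sup>2 else 0) - 4 / S * (x $ i * x $ j * p x))"
    unfolding dc' 
    by (subst partial_deriv_cmult[OF C_class_1D(1)[OF xp]],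
        subst partial_deriv_mult[OF differentiable_nth C_class_1D(1)[OF p2]])
      (simp add: dp2 partial_deriv_nth)
  show "C_class 2 (cutoff S :: real^'n \<Rightarrow> real)"
    unfolding C_class_2_iff
  proof safe
    have "C_class 1 (cutoff S :: real^'n \<Rightarrow> real)"
      unfolding c by (rule C_class_1_compose[OF d3 _ r1]) (intro continuous_intros)
    then show "cutoff S differentiable at x" for x :: "real^'n"
      by (rule C_class_1D)
    show "C_class 1 (partial_deriv i (cutoff S :: real^'n \<Rightarrow> real))" for i
      unfolding dc' by (intro C_class_1_mult C_class_1_const xp)
  qed
qed

lemma cutoff_eq_0:
  fixes x :: "real^'n"
  assumes S: "0 < S" and x: "S \<le> (norm x)\<^sup>2"
  shows "cutoff S x = 0" "partial_deriv i (cutoff S) x = 0"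
proof -
  have "max 0 (1 - (norm x)\<^sup>2 / S) = 0" using S x by (simp add: max_def field_simps)
  then show "cutoff S x = 0" "partial_deriv i (cutoff S) x = 0"
    by (simp_all add: cutoff_def cutoff_derivatives(1)[OF S])
qed

lemma cutoff_ge_eighth:
  fixes x :: "real^'n"
  assumes S: "0 < S" and x: "2 * (norm x)\<^sup>2 \<le> S"
  shows "1 / 8 \<le> cutoff S x"
proof -
  have "(norm x)\<^sup>2 / S \<le> 1 / 2" using S x by (simp add: field_simps)
  then have "1 / 2 \<le> max 0 (1 - (norm x)\<^sup>2 / S)" by (intro max.coboundedI2) linarith
  then have "(1 / 2) ^ 3 \<le> cutoff S x" unfolding cutoff_def by (rule power_mono) simp
  then show ?thesis by (simp add: power3_eq_cube)
qed

text \<open>On its support the norm is at most \<open>\<surd>S\<close>, a first derivative of the cutoff is of order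
\<open>norm x / S\<close>, and a second derivative of order \<open>1 / S\<close>. So coefficients of linear and quadratic growth
are compensated uniformly in the scale \<open>S\<close>.\<close>

lemma cutoff_derivative_bounds:
  fixes x :: "real^'n"
  assumes S: "1 \<le> S"
  shows "(1 + norm x) * \<bar>partial_deriv i (cutoff S) x\<bar> \<le> 12"
    and "(1 + norm x)\<^sup>2 * \<bar>partial_deriv i (partial_deriv j (cutoff S)) x\<bar> \<le> 120"
proof -
  define p where "p = max 0 (1 - (norm x)\<^sup>2 / S)"
  have S0: "0 < S" using S by simp
  have d1: "partial_deriv i (cutoff S) x = - (6 / S) * (x $ i * p\<^sup>2)"
    and d2: "partial_deriv i (partial_deriv j (cutoff S)) x =
      - (6 / S) * ((if i = j then p\<^sup>2 else 0) - 4 / S * (x $ i * x $ j * p))"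
    unfolding p_def by (rule cutoff_derivatives[OF S0])+
  define Z where "Z = (if i = j then p\<^sup>2 else 0) - 4 / S * (x $ i * x $ j * p)"
  have d2': "partial_deriv i (partial_deriv j (cutoff S)) x = - (6 / S) * Z"
    by (simp only: d2 Z_def)
  have "(1 + norm x) * \<bar>partial_deriv i (cutoff S) x\<bar> \<le> 12 \<and>
      (1 + norm x)\<^sup>2 * \<bar>partial_deriv i (partial_deriv j (cutoff S)) x\<bar> \<le> 120"
  proof (cases "p = 0")
    case True
    then show ?thesis by (simp add: d1 d2)
  next
    case False
    then have n: "(norm x)\<^sup>2 \<le> S" and p: "0 \<le> p" "p \<le> 1"
      using S0 by (auto simp: p_def max_def field_simps split: if_splits)
    have p2: "p\<^sup>2 \<le> 1" using p by (simp add: power_le_one)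
    have xi: "\<bar>x $ k\<bar> \<le> norm x" for k by (rule component_le_norm_cart)
    have n1: "norm x \<le> S"
    proof (cases "norm x \<le> 1")
      case False
      then have "norm x * 1 \<le> norm x * norm x" by (intro mult_left_mono) auto
      with n show ?thesis by (simp add: power2_eq_square)
    qed (use S in simp)
    have "\<bar>x $ i * p\<^sup>2\<bar> \<le> norm x * 1"
      unfolding abs_mult using xi p2 by (intro mult_mono) auto
    then have "(1 + norm x) * \<bar>x $ i * p\<^sup>2\<bar> \<le> (1 + norm x) * norm x"
      by (intro mult_left_mono) auto
    also have "\<dots> \<le> 2 * S" using n n1 by (simp add: power2_eq_square algebra_simps)
    finally have A: "(1 + norm x) * \<bar>partial_deriv i (cutoff S) x\<bar> \<le> 12"
      using S0 by (simp add: d1 abs_mult field_simps)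
    have "\<bar>x $ i * x $ j * p\<bar> \<le> norm x * norm x * 1"
      unfolding abs_mult using xi p by (intro mult_mono) auto
    then have "4 / S * \<bar>x $ i * x $ j * p\<bar> \<le> 4 / S * S"
      using n S0 by (intro mult_left_mono) (auto simp: power2_eq_square)
    then have "\<bar>4 / S * (x $ i * x $ j * p)\<bar> \<le> 4"
      using S0 by (simp add: abs_mult)
    moreover have "\<bar>if i = j then p\<^sup>2 else 0\<bar> \<le> 1" using p2 by simp
    ultimately have "\<bar>Z\<bar> \<le> 5"
      using abs_triangle_ineq4[of "if i = j then p\<^sup>2 else 0" "4 / S * (x $ i * x $ j * p)"]
      unfolding Z_def by linarith
    then have h: "\<bar>partial_deriv i (partial_deriv j (cutoff S)) x\<bar> \<le> 30 / S"
      using S0 by (simp add: d2' abs_mult field_simps)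
    have "(1 + norm x)\<^sup>2 \<le> 4 * S"
      using n n1 S by (simp add: power2_eq_square algebra_simps)
    then have "(1 + norm x)\<^sup>2 * \<bar>partial_deriv i (partial_deriv j (cutoff S)) x\<bar> \<le> 4 * S * (30 / S)"
      using h S0 by (intro mult_mono) auto
    with A S0 show ?thesis by simp
  qed
  then show "(1 + norm x) * \<bar>partial_deriv i (cutoff S) x\<bar> \<le> 12"
    and "(1 + norm x)\<^sup>2 * \<bar>partial_deriv i (partial_deriv j (cutoff S)) x\<bar> \<le> 120" by auto
qed

section \<open>The energy estimate\<close>

text \<open>Turns growth at infinity of a continuous function into a bound on the whole space; the weight
\<open>1 + norm x\<close> avoids the singularity of negative powers at the origin.\<close>

lemma polynomial_growth_bound:
  fixes f :: "real^'n \<Rightarrow> real"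
  assumes f: "continuous_on UNIV f" and O: "f \<in> O[at_infinity](\<lambda>x. norm x powr p)" and p: "p \<le> real k"
  obtains C where "0 \<le> C" "\<And>x. \<bar>f x\<bar> \<le> C * (1 + norm x) ^ k"
proof -
  obtain c where c: "0 < c" "\<forall>\<^sub>F x in at_infinity. norm (f x) \<le> c * norm (norm x powr p)"
    using O by (elim landau_o.bigE)
  then obtain N where N: "\<And>x. N \<le> norm x \<Longrightarrow> \<bar>f x\<bar> \<le> c * (norm x powr p)"
    by (auto simp: eventually_at_infinity)
  define R where "R = max 1 N"
  have "bounded (f ` cball 0 R)"
    by (intro compact_imp_bounded compact_continuous_image continuous_on_subset[OF f]) auto
  then obtain K where K: "\<And>x. x \<in> cball 0 R \<Longrightarrow> \<bar>f x\<bar> \<le> K"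
    by (metis bounded_iff imageI real_norm_def)
  have R1: "1 \<le> R" by (simp add: R_def)
  have K0: "0 \<le> K" using K[of 0] R1 by (simp add: order_trans[OF abs_ge_zero])
  show thesis
  proof (rule that[of "c + K"])
    show "0 \<le> c + K" using c(1) K0 by simp
    fix x :: "real^'n"
    have one: "1 \<le> (1 + norm x) ^ k" by (rule one_le_power) simp
    show "\<bar>f x\<bar> \<le> (c + K) * (1 + norm x) ^ k"
    proof (cases "norm x \<le> R")
      case True
      have "\<bar>f x\<bar> \<le> K * 1" using K[of x] True by simp
      also have "\<dots> \<le> K * (1 + norm x) ^ k" using one K0 by (intro mult_left_mono) auto
      also have "\<dots> \<le> (c + K) * (1 + norm x) ^ k" using c(1) one by (intro mult_right_mono) auto
      finally show ?thesis .
    next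
      case False
      then have x: "1 \<le> norm x" "N \<le> norm x" by (auto simp: R_def)
      have "norm x powr p \<le> norm x powr real k" using x(1) p by (rule powr_mono[rotated])
      also have "\<dots> = norm x ^ k" by (rule powr_realpow) (use x(1) in linarith)
      also have "\<dots> \<le> (1 + norm x) ^ k" by (intro power_mono) auto
      finally have "c * (norm x powr p) \<le> c * (1 + norm x) ^ k" using c(1) by simp
      also have "\<dots> \<le> (c + K) * (1 + norm x) ^ k" using K0 one by (intro mult_right_mono) auto
      finally show ?thesis using N[OF x(2)] by simp
    qed
  qed
qed

text \<open>The field \<open>F\<close> is what one integrates by parts when testing the equation with \<open>\<phi> g'(u)\<close>. Its second part
moves the derivatives of \<open>g(u)\<close> onto the coefficients and the cutoff: the terms
\<open>g'(u) A\<nabla>u \<bullet> \<nabla>\<phi>\<close> and \<open>g'(u) \<nabla>u \<bullet> A\<nabla>\<phi>\<close> cancel by the symmetry of \<open>a\<close>, so no first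
derivative of \<open>u\<close> remains outside the equation and the quadratic form. Having the identity pointwise
confines integration to continuous functions.\<close>

lemma energy_flux:
  fixes a :: "2 \<Rightarrow> 2 \<Rightarrow> real^2 \<Rightarrow> real" and b :: "real^2 \<Rightarrow> real^2" and u \<phi> :: "real^2 \<Rightarrow> real"
  assumes a: "\<And>i j. C_class 1 (a i j)" "\<And>i j. a i j = a j i"
    and b: "\<And>i. C_class 1 (\<lambda>x. b x $ i)"
    and u: "C_class 2 u" and \<phi>: "C_class 2 \<phi>"
    and g: "\<And>s. (g has_real_derivative g' s) (at s)"
    and g': "\<And>s. (g' has_real_derivative g'' s) (at s)" and g'': "continuous_on UNIV g''"
  defines "F \<equiv> \<lambda>i x. \<phi> x * g' (u x) * (\<Sum>j\<in>UNIV. a i j x * partial_deriv j u x)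
      - g (u x) * ((\<Sum>j\<in>UNIV. a i j x * partial_deriv j \<phi> x) + \<phi> x * b x $ i)"
  shows "C_class 1 (F i)"
    and "(\<Sum>i\<in>UNIV. partial_deriv i (F i) x) =
      \<phi> x * g'' (u x) * (\<Sum>i\<in>UNIV. \<Sum>j\<in>UNIV. a i j x * partial_deriv i u x * partial_deriv j u x)
      + \<phi> x * g' (u x) * ((\<Sum>i\<in>UNIV. \<Sum>j\<in>UNIV. partial_deriv i (\<lambda>y. a i j y * partial_deriv j u y) x)
          - b x \<bullet> gradient u x)
      - g (u x) * ((\<Sum>i\<in>UNIV. (\<Sum>j\<in>UNIV. partial_deriv i (a i j) x * partial_deriv j \<phi> x
            + a i j x * partial_deriv i (partial_deriv j \<phi>) x) + b x $ i * partial_deriv i \<phi> x)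
          + \<phi> x * divergence b x)"
proof -
  have u1: "C_class 1 u" "C_class 1 (partial_deriv j u)" and \<phi>1: "C_class 1 \<phi>" "C_class 1 (partial_deriv j \<phi>)" for j
    using u \<phi> by (auto simp: C_class_2_iff C_class_1_iff[of u] C_class_1_iff[of \<phi>] intro: C_class_1D simp del: One_nat_def C_class.simps)
  have contg': "continuous_on UNIV g'"
    using g' by (meson DERIV_isCont continuous_at_imp_continuous_on)
  have gu: "C_class 1 (\<lambda>x. g (u x))" by (rule C_class_1_compose[OF g contg' u1(1)])
  have g'u: "C_class 1 (\<lambda>x. g' (u x))" by (rule C_class_1_compose[OF g' g'' u1(1)])
  have dgu: "partial_deriv i (\<lambda>x. g (u x)) x = g' (u x) * partial_deriv i u x"
    and dg'u: "partial_deriv i (\<lambda>x. g' (u x)) x = g'' (u x) * partial_deriv i u x" for i x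
    by (rule partial_deriv_compose[OF g C_class_1D(1)[OF u1(1)]],
        rule partial_deriv_compose[OF g' C_class_1D(1)[OF u1(1)]])
  have au: "C_class 1 (\<lambda>x. a i j x * partial_deriv j u x)" for i j
    by (rule C_class_1_mult[OF a(1) u1(2)])
  have a\<phi>: "C_class 1 (\<lambda>x. a i j x * partial_deriv j \<phi> x)" for i j
    by (rule C_class_1_mult[OF a(1) \<phi>1(2)])
  have V: "C_class 1 (\<lambda>x. \<Sum>j\<in>UNIV. a i j x * partial_deriv j u x)" for i
    by (rule C_class_1_sum[OF au])
  have W: "C_class 1 (\<lambda>x. \<Sum>j\<in>UNIV. a i j x * partial_deriv j \<phi> x)" for i
    by (rule C_class_1_sum[OF a\<phi>])
  have \<phi>b: "C_class 1 (\<lambda>x. \<phi> x * b x $ i)" for i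
    by (rule C_class_1_mult[OF \<phi>1(1) b])
  have Wb: "C_class 1 (\<lambda>x. (\<Sum>j\<in>UNIV. a i j x * partial_deriv j \<phi> x) + \<phi> x * b x $ i)" for i
    by (rule C_class_1_add[OF W \<phi>b])
  have \<phi>g: "C_class 1 (\<lambda>x. \<phi> x * g' (u x))" by (rule C_class_1_mult[OF \<phi>1(1) g'u])
  show "C_class 1 (F i)" unfolding F_def
    by (intro C_class_1_diff C_class_1_mult \<phi>1 g'u V gu Wb)
  have dF: "partial_deriv i (F i) x =
      (partial_deriv i \<phi> x * g' (u x) + \<phi> x * (g'' (u x) * partial_deriv i u x)) * (\<Sum>j\<in>UNIV. a i j x * partial_deriv j u x)
      + \<phi> x * g' (u x) * (\<Sum>j\<in>UNIV. partial_deriv i (\<lambda>y. a i j y * partial_deriv j u y) x)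
      - (g' (u x) * partial_deriv i u x * ((\<Sum>j\<in>UNIV. a i j x * partial_deriv j \<phi> x) + \<phi> x * b x $ i)
        + g (u x) * ((\<Sum>j\<in>UNIV. partial_deriv i (a i j) x * partial_deriv j \<phi> x + a i j x * partial_deriv i (partial_deriv j \<phi>) x)
          + (partial_deriv i \<phi> x * b x $ i + \<phi> x * partial_deriv i (\<lambda>y. b y $ i) x)))" for i
    unfolding F_def
    by (simp only: partial_deriv_diff[OF C_class_1D(1)[OF C_class_1_mult[OF \<phi>g V]] C_class_1D(1)[OF C_class_1_mult[OF gu Wb]]]
        partial_deriv_mult[OF C_class_1D(1)[OF \<phi>g] C_class_1D(1)[OF V]]
        partial_deriv_mult[OF C_class_1D(1)[OF gu] C_class_1D(1)[OF Wb]]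
        partial_deriv_mult[OF C_class_1D(1)[OF \<phi>1(1)] C_class_1D(1)[OF g'u]]
        partial_deriv_add[OF C_class_1D(1)[OF W] C_class_1D(1)[OF \<phi>b]]
        partial_deriv_mult[OF C_class_1D(1)[OF \<phi>1(1)] C_class_1D(1)[OF b]]
        partial_deriv_sum[OF finite C_class_1D(1)[OF au]]
        partial_deriv_sum[OF finite C_class_1D(1)[OF a\<phi>]]
        partial_deriv_mult[OF C_class_1D(1)[OF a(1)] C_class_1D(1)[OF \<phi>1(2)]]
        dgu dg'u)
  show "(\<Sum>i\<in>UNIV. partial_deriv i (F i) x) =
      \<phi> x * g'' (u x) * (\<Sum>i\<in>UNIV. \<Sum>j\<in>UNIV. a i j x * partial_deriv i u x * partial_deriv j u x)
      + \<phi> x * g' (u x) * ((\<Sum>i\<in>UNIV. \<Sum>j\<in>UNIV. partial_deriv i (\<lambda>y. a i j y * partial_deriv j u y) x)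
          - b x \<bullet> gradient u x)
      - g (u x) * ((\<Sum>i\<in>UNIV. (\<Sum>j\<in>UNIV. partial_deriv i (a i j) x * partial_deriv j \<phi> x
            + a i j x * partial_deriv i (partial_deriv j \<phi>) x) + b x $ i * partial_deriv i \<phi> x)
          + \<phi> x * divergence b x)"
    unfolding dF using a(2)[of 2 1]
    by (simp add: sum_2 inner_vec_def gradient_def divergence_def algebra_simps)
qed

text \<open>There are four pairs of indices, each with one product of a first derivative (at most \<open>12 C\<close>) and one of a
second derivative (at most \<open>120 C\<close>), and two drift terms (at most \<open>12 C\<close>), hence the constant
\<open>552 = 4 * (12 + 120) + 2 * 12\<close>.\<close>

lemma cutoff_error_bound:
  fixes a :: "2 \<Rightarrow> 2 \<Rightarrow> real^2 \<Rightarrow> real" and b :: "real^2 \<Rightarrow> real^2" and x :: "real^2"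
  assumes C: "0 \<le> C" and S: "1 \<le> S"
    and a: "\<And>i j. \<bar>a i j x\<bar> \<le> C * (1 + norm x)\<^sup>2"
      "\<And>i j. \<bar>partial_deriv i (a i j) x\<bar> \<le> C * (1 + norm x)"
    and b: "\<And>i. \<bar>b x $ i\<bar> \<le> C * (1 + norm x)"
  shows "\<bar>\<Sum>i\<in>UNIV. (\<Sum>j\<in>UNIV. partial_deriv i (a i j) x * partial_deriv j (cutoff S) x
            + a i j x * partial_deriv i (partial_deriv j (cutoff S)) x) + b x $ i * partial_deriv i (cutoff S) x\<bar>
      \<le> 552 * C"
proof -
  have first: "\<bar>y * partial_deriv k (cutoff S) x\<bar> \<le> 12 * C" if y: "\<bar>y\<bar> \<le> C * (1 + norm x)" for y k
  proof -
    have "\<bar>y * partial_deriv k (cutoff S) x\<bar> \<le> C * (1 + norm x) * \<bar>partial_deriv k (cutoff S) x\<bar>"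
      using y by (simp add: abs_mult mult_right_mono)
    also have "\<dots> \<le> C * 12"
      using mult_left_mono[OF cutoff_derivative_bounds(1)[OF S] C] by (simp add: mult.assoc)
    finally show ?thesis by simp
  qed
  have second: "\<bar>a i j x * partial_deriv i (partial_deriv j (cutoff S)) x\<bar> \<le> 120 * C" for i j
  proof -
    have "\<bar>a i j x * partial_deriv i (partial_deriv j (cutoff S)) x\<bar>
        \<le> C * (1 + norm x)\<^sup>2 * \<bar>partial_deriv i (partial_deriv j (cutoff S)) x\<bar>"
      using a(1) by (simp add: abs_mult mult_right_mono)
    also have "\<dots> \<le> C * 120"
      using mult_left_mono[OF cutoff_derivative_bounds(2)[OF S] C] by (simp add: mult.assoc)
    finally show ?thesis by simp
  qed
  have "\<bar>(\<Sum>j\<in>UNIV. partial_deriv i (a i j) x * partial_deriv j (cutoff S) x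
            + a i j x * partial_deriv i (partial_deriv j (cutoff S)) x) + b x $ i * partial_deriv i (cutoff S) x\<bar> \<le> 276 * C" for i
    using first[OF a(2), of i 1 1] first[OF a(2), of i 2 2] second[of i 1] second[of i 2] first[OF b, of i i]
    unfolding sum_2 by linarith
  from this[of 1] this[of 2] show ?thesis
    unfolding sum_2 by linarith
qed

text \<open>The divergence of the flux with \<open>\<phi> = cutoff (4 L\<^sup>2)\<close> integrates to zero over the square of half side
\<open>2 L\<close>, outside which \<open>\<phi>\<close> vanishes, and it is bounded below pointwise by
\<open>lam \<phi> g''(u) \<bar>\<nabla>u\<bar>\<^sup>2 - M g(u)\<close> with \<open>M\<close> independent of \<open>L\<close>. For that bound,
\<open>\<phi> c u g'(u) \<ge> 2 \<phi> c g(u)\<close> absorbs the part \<open>2 c\<close> of \<open>div b\<close>, and the growth conditions control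
all terms with derivatives of \<open>\<phi>\<close>. On the square of half side \<open>L\<close> one has \<open>\<phi> \<ge> 1/8\<close>.\<close>

lemma energy_estimate:
  fixes a :: "2 \<Rightarrow> 2 \<Rightarrow> real^2 \<Rightarrow> real" and b :: "real^2 \<Rightarrow> real^2" and c u :: "real^2 \<Rightarrow> real"
  assumes a: "\<And>i j. C_class 1 (a i j)" "\<And>i j. a i j = a j i" and lam: "0 < lam"
    and ell: "\<And>x \<xi>. (\<Sum>i\<in>UNIV. \<Sum>j\<in>UNIV. a i j x * \<xi> $ i * \<xi> $ j) \<ge> lam * (norm \<xi>)\<^sup>2"
    and b: "\<And>i. C_class 1 (\<lambda>x. b x $ i)"
    and C: "0 \<le> C" "\<And>i j x. \<bar>a i j x\<bar> \<le> C * (1 + norm x)\<^sup>2"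
      "\<And>i j x. \<bar>partial_deriv i (a i j) x\<bar> \<le> C * (1 + norm x)" "\<And>i x. \<bar>b x $ i\<bar> \<le> C * (1 + norm x)"
    and c: "\<And>x. 0 \<le> c x" and K: "0 \<le> K" "\<And>x. divergence b x \<le> K + 2 * c x"
    and u: "C_class 2 u"
    and eq: "\<And>x. - (\<Sum>i\<in>UNIV. \<Sum>j\<in>UNIV. partial_deriv i (\<lambda>y. a i j y * partial_deriv j u y) x)
             + b x \<bullet> gradient u x + c x * u x = 0"
    and g: "\<And>s. (g has_real_derivative g' s) (at s)"
    and g': "\<And>s. (g' has_real_derivative g'' s) (at s)" and g'': "continuous_on UNIV g''"
    and pos: "\<And>s. 0 \<le> g s" "\<And>s. 0 \<le> g'' s" "\<And>s. 2 * g s \<le> g' s * s"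
    and E: "\<And>L. square_integral L (\<lambda>x. g (u x)) \<le> E"
    and L: "1 \<le> L"
  shows "square_integral L (\<lambda>x. g (u x) + g'' (u x) * (norm (gradient u x))\<^sup>2)
      \<le> E + 8 * ((552 * C + K) * E / lam)"
proof -
  define S where "S = 4 * L\<^sup>2"
  define \<phi> where "\<phi> = (cutoff S :: real^2 \<Rightarrow> real)"
  define M where "M = 552 * C + K"
  define D where "D x = g'' (u x) * (norm (gradient u x))\<^sup>2" for x
  have S1: "1 \<le> S" using L one_le_power[of L 2] unfolding S_def by linarith
  then have S0: "0 < S" by simp
  have M: "0 \<le> M" using C(1) K(1) by (simp add: M_def)
  have \<phi>2: "C_class 2 \<phi>" unfolding \<phi>_def by (rule cutoff_derivatives(3)[OF S0])
  have \<phi>_bd: "0 \<le> \<phi> x" "\<phi> x \<le> 1" for x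
    using cutoff_bounds[OF S0] by (simp_all add: \<phi>_def)
  define F where "F i x = \<phi> x * g' (u x) * (\<Sum>j\<in>UNIV. a i j x * partial_deriv j u x)
      - g (u x) * ((\<Sum>j\<in>UNIV. a i j x * partial_deriv j \<phi> x) + \<phi> x * b x $ i)" for i x
  have F1: "C_class 1 (F i)" for i
    unfolding F_def by (rule energy_flux(1)[OF a b u \<phi>2 g g' g''])
  have divF: "lam * (\<phi> x * D x) - M * g (u x) \<le> (\<Sum>i\<in>UNIV. partial_deriv i (F i) x)" for x
  proof -
    define P where "P = (\<Sum>i\<in>UNIV. \<Sum>j\<in>UNIV. a i j x * partial_deriv i u x * partial_deriv j u x)"
    define Q where "Q = (\<Sum>i\<in>UNIV. (\<Sum>j\<in>UNIV. partial_deriv i (a i j) x * partial_deriv j \<phi> x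
            + a i j x * partial_deriv i (partial_deriv j \<phi>) x) + b x $ i * partial_deriv i \<phi> x)"
    have P: "lam * (norm (gradient u x))\<^sup>2 \<le> P"
      using ell[where x = x and \<xi> = "gradient u x"] by (simp add: P_def gradient_def)
    have Q: "\<bar>Q\<bar> \<le> 552 * C"
      unfolding Q_def \<phi>_def by (rule cutoff_error_bound[OF C(1) S1 C(2,3,4)])
    have "(\<Sum>i\<in>UNIV. \<Sum>j\<in>UNIV. partial_deriv i (\<lambda>y. a i j y * partial_deriv j u y) x) - b x \<bullet> gradient u x = c x * u x"
      using eq[of x] by linarith
    then have "(\<Sum>i\<in>UNIV. partial_deriv i (F i) x) =
        \<phi> x * g'' (u x) * P + \<phi> x * g' (u x) * (c x * u x) - g (u x) * (Q + \<phi> x * divergence b x)"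
      unfolding P_def Q_def F_def[abs_def] by (simp only: energy_flux(2)[OF a b u \<phi>2 g g' g''])
    moreover have "\<phi> x * g'' (u x) * (lam * (norm (gradient u x))\<^sup>2) \<le> \<phi> x * g'' (u x) * P"
      using P \<phi>_bd pos by (intro mult_left_mono) auto
    moreover have "(\<phi> x * c x) * (2 * g (u x)) \<le> (\<phi> x * c x) * (g' (u x) * u x)"
      using c \<phi>_bd pos by (intro mult_left_mono) auto
    moreover have "g (u x) * Q \<le> g (u x) * (552 * C)"
      using Q pos(1) by (intro mult_left_mono) auto
    moreover have "(g (u x) * \<phi> x) * divergence b x \<le> (g (u x) * \<phi> x) * (K + 2 * c x)"
      using K pos(1) \<phi>_bd by (intro mult_left_mono) auto
    moreover have "(g (u x) * K) * \<phi> x \<le> (g (u x) * K) * 1"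
      using K pos(1) \<phi>_bd by (intro mult_left_mono) auto
    ultimately show ?thesis
      unfolding D_def M_def by (simp add: algebra_simps)
  qed
  have u1: "C_class 1 (partial_deriv i u)" "C_class 1 u" for i
    using u by (auto simp: C_class_2_iff C_class_1_iff[of u] intro: C_class_1D simp del: One_nat_def C_class.simps)
  have "continuous_on UNIV g"
    using g by (meson DERIV_isCont continuous_at_imp_continuous_on)
  then have gu: "continuous_on UNIV (\<lambda>x. g (u x))"
    by (rule continuous_on_compose2[OF _ C_class_1D(3)[OF u1(2)]]) simp
  have D_alt: "D x = g'' (u x) * (\<Sum>i\<in>UNIV. (partial_deriv i u x)\<^sup>2)" for x
    by (simp add: D_def norm_vec_def L2_set_def gradient_def sum_nonneg)
  have Dc: "continuous_on UNIV D"
    unfolding D_alt[abs_def]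
    by (intro continuous_intros C_class_1D(3)[OF u1(1)] continuous_on_compose2[OF g'' C_class_1D(3)[OF u1(2)]]) auto
  have D0: "0 \<le> D x" for x using pos by (simp add: D_def)
  have \<phi>c: "continuous_on UNIV \<phi>"
    using \<phi>2 by (auto simp: C_class_2_iff continuous_at_imp_continuous_on differentiable_imp_continuous_within)
  have "square_integral (2 * L) (\<lambda>x. \<Sum>i\<in>UNIV. partial_deriv i (F i) x) = 0"
  proof (rule square_integral_divergence_eq_0[OF F1])
    fix i and x :: "real^2" assume "2 * L \<le> \<bar>x $ i\<bar>"
    then have "2 * L \<le> norm x" using component_le_norm_cart[of x i] by linarith
    then have "S \<le> (norm x)\<^sup>2"
      unfolding S_def using L power_mono[of "2 * L" "norm x" 2] by (simp add: power_mult_distrib)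
    from cutoff_eq_0[OF S0 this] show "F i x = 0" by (simp add: F_def \<phi>_def)
  qed (use L in simp)
  moreover have "square_integral (2 * L) (\<lambda>x. lam * (\<phi> x * D x) + (- M) * g (u x))
      \<le> square_integral (2 * L) (\<lambda>x. \<Sum>i\<in>UNIV. partial_deriv i (F i) x)"
    using divF by (intro square_integral_mono continuous_intros \<phi>c Dc gu C_class_1D(2)[OF F1]) auto
  moreover have "square_integral (2 * L) (\<lambda>x. lam * (\<phi> x * D x) + (- M) * g (u x)) =
      lam * square_integral (2 * L) (\<lambda>x. \<phi> x * D x) + (- M) * square_integral (2 * L) (\<lambda>x. g (u x))"
    by (subst square_integral_add) (auto simp only: square_integral_cmult intro!: continuous_intros \<phi>c Dc gu)
  moreover have "M * square_integral (2 * L) (\<lambda>x. g (u x)) \<le> M * E"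
    using E M by (rule mult_left_mono)
  ultimately have "lam * square_integral (2 * L) (\<lambda>x. \<phi> x * D x) \<le> M * E"
    by linarith
  then have main: "square_integral (2 * L) (\<lambda>x. \<phi> x * D x) \<le> M * E / lam"
    using lam by (simp add: pos_le_divide_eq mult.commute)
  have "square_integral L D \<le> square_integral L (\<lambda>x. 8 * (\<phi> x * D x))"
  proof (rule square_integral_mono)
    fix x :: "real^2" assume x: "\<bar>x $ 1\<bar> \<le> L" "\<bar>x $ 2\<bar> \<le> L"
    have "(norm x)\<^sup>2 = (x $ 1)\<^sup>2 + (x $ 2)\<^sup>2"
      by (simp add: norm_vec_def L2_set_def sum_2)
    also have "\<dots> \<le> L\<^sup>2 + L\<^sup>2"
      using x L by (intro add_mono) (simp_all add: abs_le_square_iff[symmetric])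
    finally have "1 / 8 \<le> \<phi> x"
      unfolding \<phi>_def by (intro cutoff_ge_eighth[OF S0]) (simp add: S_def)
    from mult_right_mono[OF this D0[of x]] show "D x \<le> 8 * (\<phi> x * D x)" by simp
  qed (intro continuous_intros Dc \<phi>c)+
  also have "\<dots> = 8 * square_integral L (\<lambda>x. \<phi> x * D x)" by (rule square_integral_cmult)
  also have "square_integral L (\<lambda>x. \<phi> x * D x) \<le> square_integral (2 * L) (\<lambda>x. \<phi> x * D x)"
    using L \<phi>_bd D0 by (intro square_integral_mono_domain continuous_intros Dc \<phi>c) auto
  finally have "square_integral L D \<le> 8 * (M * E / lam)" using main by simp
  moreover have "square_integral L (\<lambda>x. g (u x) + D x) = square_integral L (\<lambda>x. g (u x)) + square_integral L D"
    by (rule square_integral_add[OF gu Dc])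
  ultimately show ?thesis
    using E[of L] unfolding D_def M_def by linarith
qed

section \<open>Smallness on the boundary of a square\<close>

text \<open>With \<open>\<Psi> = g(u) + g''(u) \<bar>\<nabla>u\<bar>\<^sup>2\<close>, both \<open>g(u)\<close> and \<open>\<bar>\<nabla>(g(u))\<bar>\<close> are at most \<open>\<Psi>\<close>. On a square
whose sides carry little of the integral of \<open>\<Psi>\<close>, the one-dimensional Sobolev inequality makes
\<open>g(u)\<close> uniformly small. This is the step that is special to the plane: the boundary is one-dimensional,
so an integral bound on one derivative yields a pointwise bound.\<close>

lemma small_on_boundary_of_a_square:
  fixes u :: "real^2 \<Rightarrow> real"
  assumes u: "C_class 2 u"
    and g: "\<And>s. (g has_real_derivative g' s) (at s)" and g'': "continuous_on UNIV g''"
    and pos: "\<And>s. 0 \<le> g s" "\<And>s. 0 \<le> g'' s" "\<And>s. (g' s)\<^sup>2 \<le> 2 * g s * g'' s"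
    and R: "1 \<le> R"
    and E: "square_integral (2 * R) (\<lambda>x. g (u x) + g'' (u x) * (norm (gradient u x))\<^sup>2) \<le> E"
  obtains r where "R \<le> r" "\<And>x. x \<in> frontier (cbox (vector [-r, -r]) (vector [r, r])) \<Longrightarrow> g (u x) \<le> 2 * ((4 * E + 1) / R)"
proof -
  define \<Psi> where "\<Psi> x = g (u x) + g'' (u x) * (norm (gradient u x))\<^sup>2" for x
  have u1: "C_class 1 (partial_deriv i u)" "C_class 1 u" for i
    using u by (auto simp: C_class_2_iff C_class_1_iff[of u] intro: C_class_1D simp del: One_nat_def C_class.simps)
  have "continuous_on UNIV g"
    using g by (meson DERIV_isCont continuous_at_imp_continuous_on)
  then have gu: "continuous_on UNIV (\<lambda>x. g (u x))"
    by (rule continuous_on_compose2[OF _ C_class_1D(3)[OF u1(2)]]) simp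
  have norm_grad: "(norm (gradient u x))\<^sup>2 = (\<Sum>i\<in>UNIV. (partial_deriv i u x)\<^sup>2)" for x
    by (simp add: norm_vec_def L2_set_def gradient_def sum_nonneg)
  have \<Psi>c: "continuous_on UNIV \<Psi>"
    unfolding \<Psi>_def[abs_def] norm_grad
    by (intro continuous_intros gu C_class_1D(3)[OF u1(1)] continuous_on_compose2[OF g'' C_class_1D(3)[OF u1(2)]]) auto
  have \<Psi>0: "0 \<le> \<Psi> x" and g_le: "g (u x) \<le> \<Psi> x" for x using pos by (simp_all add: \<Psi>_def)
  have deriv_le: "\<bar>g' (u x) * partial_deriv i u x\<bar> \<le> \<Psi> x" for i x
  proof -
    have d: "(partial_deriv i u x)\<^sup>2 \<le> (norm (gradient u x))\<^sup>2"
      unfolding norm_grad by (rule member_le_sum) auto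
    have "(g' (u x) * partial_deriv i u x)\<^sup>2 \<le> (2 * g (u x) * g'' (u x)) * (norm (gradient u x))\<^sup>2"
      unfolding power_mult_distrib using pos d by (intro mult_mono) auto
    also have "\<dots> \<le> (\<Psi> x)\<^sup>2"
      using pos by (simp add: \<Psi>_def power2_sum)
    finally show ?thesis using \<Psi>0 by (simp add: abs_le_square_iff[symmetric])
  qed
  have E0: "0 \<le> E" using square_integral_nonneg[OF \<Psi>c \<Psi>0] E unfolding \<Psi>_def by (rule order_trans)
  have pos': "0 < (4 * E + 1) / R" using E0 R by simp
  have E': "square_integral (2 * R) \<Psi> \<le> E" using E by (simp add: \<Psi>_def[abs_def])
  have R0: "0 < R" using R by simp
  from exists_square_small_on_sides[OF \<Psi>c \<Psi>0 R0 E']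
  obtain r where r: "R \<le> r" "r \<le> 2 * R"
    and i1: "\<And>s. \<bar>s\<bar> = r \<Longrightarrow> integral {-2*R..2*R} (\<lambda>y. \<Psi> (vector [s, y])) \<le> (4 * E + 1) / R"
    and i2: "\<And>s. \<bar>s\<bar> = r \<Longrightarrow> integral {-2*R..2*R} (\<lambda>x. \<Psi> (vector [x, s])) \<le> (4 * E + 1) / R"
    by blast
  note ud = C_class_1D(1)[OF u1(2)]
  show thesis
  proof (rule that[OF r(1)])
    fix x :: "real^2" assume x: "x \<in> frontier (cbox (vector [-r, -r]) (vector [r, r]))"
    have xe: "x = vector [x $ 1, x $ 2]" by (simp add: vec_eq_iff forall_2)
    have "\<bar>x $ 1\<bar> \<le> r" "\<bar>x $ 2\<bar> \<le> r" "\<bar>x $ 1\<bar> = r \<or> \<bar>x $ 2\<bar> = r"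
      using x unfolding frontier_cbox by (auto simp: mem_box_cart forall_2 not_less)
    then show "g (u x) \<le> 2 * ((4 * E + 1) / R)"
    proof (elim disjE)
      assume 1: "\<bar>x $ 1\<bar> = r" and 2: "\<bar>x $ 2\<bar> \<le> r"
      have "g (u (vector [x $ 1, x $ 2])) \<le> 2 * ((4 * E + 1) / R)"
      proof (rule sup_bound_from_integral[where g = "\<lambda>t. g (u (vector [x $ 1, t]))" and \<psi> = "\<lambda>t. \<Psi> (vector [x $ 1, t])"
            and g' = "\<lambda>t. g' (u (vector [x $ 1, t])) * partial_deriv 2 u (vector [x $ 1, t])" and L = "2 * R"])
        show "((\<lambda>t. g (u (vector [x $ 1, t]))) has_real_derivative
            g' (u (vector [x $ 1, t])) * partial_deriv 2 u (vector [x $ 1, t])) (at t)" for t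
          by (rule DERIV_chain2[OF g has_real_derivative_along_axes(2)[OF ud]])
        show "continuous_on UNIV (\<lambda>t. \<Psi> (vector [x $ 1, t]))"
          by (intro continuous_on_compose2[OF \<Psi>c] continuous_intros) auto
      qed (use 2 R r g_le deriv_le i1[OF 1] pos' in auto)
      then show ?thesis using xe by simp
    next
      assume 1: "\<bar>x $ 2\<bar> = r" and 2: "\<bar>x $ 1\<bar> \<le> r"
      have "g (u (vector [x $ 1, x $ 2])) \<le> 2 * ((4 * E + 1) / R)"
      proof (rule sup_bound_from_integral[where g = "\<lambda>t. g (u (vector [t, x $ 2]))" and \<psi> = "\<lambda>t. \<Psi> (vector [t, x $ 2])"
            and g' = "\<lambda>t. g' (u (vector [t, x $ 2])) * partial_deriv 1 u (vector [t, x $ 2])" and L = "2 * R"])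
        show "((\<lambda>t. g (u (vector [t, x $ 2]))) has_real_derivative
            g' (u (vector [t, x $ 2])) * partial_deriv 1 u (vector [t, x $ 2])) (at t)" for t
          by (rule DERIV_chain2[OF g has_real_derivative_along_axes(1)[OF ud]])
        show "continuous_on UNIV (\<lambda>t. \<Psi> (vector [t, x $ 2]))"
          by (intro continuous_on_compose2[OF \<Psi>c] continuous_intros) auto
      qed (use 2 R r g_le deriv_le i2[OF 1] pos' in auto)
      then show ?thesis using xe by simp
    qed
  qed
qed

section \<open>Decay and uniqueness\<close>

theorem corollary1p2:
  fixes a :: "2 \<Rightarrow> 2 \<Rightarrow> real^2 \<Rightarrow> real"
    and b :: "real^2 \<Rightarrow> real^2"
    and c u :: "real^2 \<Rightarrow> real"
    and lam \<alpha> \<beta> q :: real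
  assumes a_C1: "\<And>i j. C_class 1 (a i j)"
    and a_sym: "\<And>i j. a i j = a j i"
    and lam_pos: "lam > 0"
    and a_elliptic:
      "\<And>x \<xi>. (\<Sum>i\<in>UNIV. \<Sum>j\<in>UNIV. a i j x * \<xi> $ i * \<xi> $ j) \<ge> lam * (norm \<xi>)\<^sup>2"
    and \<alpha>: "0 \<le> \<alpha>" "\<alpha> \<le> 2"
    and a_growth: "\<And>i j. (\<lambda>x. \<bar>a i j x\<bar>) \<in> O[at_infinity](\<lambda>x. norm x powr \<alpha>)"
    and da_growth:
      "\<And>i j. (\<lambda>x. \<bar>partial_deriv i (a i j) x\<bar>) \<in> O[at_infinity](\<lambda>x. norm x powr (\<alpha> - 1))"
    and b_C1: "\<And>i. C_class 1 (\<lambda>x. b x $ i)"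
    and \<beta>: "\<beta> \<le> 1"
    and b_growth: "(\<lambda>x. norm (b x)) \<in> O[at_infinity](\<lambda>x. norm x powr \<beta>)"
    and c_meas: "c \<in> borel_measurable lebesgue"
    and c_nonneg: "\<And>x. c x \<ge> 0"
    and div_b:
      "(\<forall>x. divergence b x \<le> 2 * c x) \<or>
       (\<lambda>x. \<bar>divergence b x\<bar>) \<in> O[at_infinity](\<lambda>x. norm x powr (\<beta> - 1))"
    and u_C2: "C_class 2 u"
    and u_solution:
      "\<And>x. - (\<Sum>i\<in>UNIV. \<Sum>j\<in>UNIV. partial_deriv i (\<lambda>y. a i j y * partial_deriv j u y) x)
             + b x \<bullet> gradient u x + c x * u x = 0"
    and q: "q \<ge> 2"
    and u_Lq: "in_Lp q u"
  shows "\<forall>x. u x = 0"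
proof -
  obtain g' g'' where g: "\<And>s. ((\<lambda>s. \<bar>s\<bar> powr q) has_real_derivative g' s) (at s)"
    and g': "\<And>s. (g' has_real_derivative g'' s) (at s)"
    and g'': "continuous_on UNIV g''" "\<And>s. 0 \<le> g'' s"
    and sg': "\<And>s. 2 * \<bar>s\<bar> powr q \<le> g' s * s"
    and g'_sq: "\<And>s. (g' s)\<^sup>2 \<le> 2 * \<bar>s\<bar> powr q * g'' s"
    by (rule abs_powr_derivatives[OF q]) (rule that, assumption+)

  \<comment> \<open>These growth hypotheses amount to quadratic growth of \<open>a\<close> and linear growth of its first
    derivatives and of \<open>b\<close>, with one common constant.\<close>
  have "\<exists>C\<ge>0. \<forall>x. \<bar>a i j x\<bar> \<le> C * (1 + norm x)\<^sup>2" for i j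
    by (rule polynomial_growth_bound[of "a i j" \<alpha> 2])
      (use a_growth[of i j] \<alpha> C_class_1D(3)[OF a_C1] in auto)
  then obtain Ca where Ca: "\<And>i j. 0 \<le> Ca i j" "\<And>i j x. \<bar>a i j x\<bar> \<le> Ca i j * (1 + norm x)\<^sup>2"
    by metis
  have "\<exists>C\<ge>0. \<forall>x. \<bar>partial_deriv i (a i j) x\<bar> \<le> C * (1 + norm x) ^ 1" for i j
    by (rule polynomial_growth_bound[of "partial_deriv i (a i j)" "\<alpha> - 1" 1])
      (use da_growth[of i j] \<alpha> C_class_1D(2)[OF a_C1] in auto)
  then obtain Cd where Cd: "\<And>i j. 0 \<le> Cd i j" "\<And>i j x. \<bar>partial_deriv i (a i j) x\<bar> \<le> Cd i j * (1 + norm x) ^ 1"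
    by metis
  have "continuous_on UNIV (\<lambda>x. norm (b x))"
    by (intro continuous_on_norm continuous_on_vec_lambda[where f = "\<lambda>i x. b x $ i", simplified] C_class_1D(3) b_C1)
  then obtain Cb where Cb: "0 \<le> Cb" "\<And>x. \<bar>norm (b x)\<bar> \<le> Cb * (1 + norm x) ^ 1"
    by (rule polynomial_growth_bound[OF _ b_growth, of 1]) (use \<beta> in auto)
  define C where "C = (\<Sum>i\<in>UNIV. \<Sum>j\<in>UNIV. Ca i j + Cd i j) + Cb"
  have le: "Ca i j + Cd i j \<le> (\<Sum>i\<in>UNIV. \<Sum>j\<in>UNIV. Ca i j + Cd i j)" for i j
    using member_le_sum[of j UNIV "\<lambda>j. Ca i j + Cd i j"] member_le_sum[of i UNIV "\<lambda>i. \<Sum>j\<in>UNIV. Ca i j + Cd i j"]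
    by (smt (verit) Ca(1) Cd(1) UNIV_I finite sum_nonneg add_nonneg_nonneg)
  have C_ge: "Ca i j \<le> C" "Cd i j \<le> C" "Cb \<le> C" "0 \<le> C" for i j
    using le[of i j] Ca(1)[of i j] Cd(1)[of i j] Cb(1) unfolding C_def by linarith+
  have C1: "\<bar>a i j x\<bar> \<le> C * (1 + norm x)\<^sup>2" for i j x
    using Ca(2)[of i j x] mult_right_mono[OF C_ge(1), of "(1 + norm x)\<^sup>2" i j] by simp
  have C2: "\<bar>partial_deriv i (a i j) x\<bar> \<le> C * (1 + norm x)" for i j x
    using Cd(2)[of i j x] mult_right_mono[OF C_ge(2), of "1 + norm x" i j] by simp
  have C3: "\<bar>b x $ i\<bar> \<le> C * (1 + norm x)" for i x
    using Cb(2)[of x] mult_right_mono[OF C_ge(3), of "1 + norm x"] component_le_norm_cart[of "b x" i] by simp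

  \<comment> \<open>The two alternatives for \<open>div b\<close> have this one-sided bound in common.\<close>
  have "\<exists>K\<ge>0. \<forall>x. divergence b x \<le> K + 2 * c x"
    using div_b
  proof
    assume "\<forall>x. divergence b x \<le> 2 * c x"
    then show ?thesis by (intro exI[of _ 0]) simp
  next
    assume O: "(\<lambda>x. \<bar>divergence b x\<bar>) \<in> O[at_infinity](\<lambda>x. norm x powr (\<beta> - 1))"
    have "continuous_on UNIV (divergence b)"
      unfolding divergence_def[abs_def] by (intro continuous_intros C_class_1D(2) b_C1)
    then obtain K where K: "0 \<le> K" "\<And>x. \<bar>divergence b x\<bar> \<le> K * (1 + norm x) ^ 0"
      by (rule polynomial_growth_bound[where p = "\<beta> - 1" and k = 0]) (use O \<beta> in auto)
    have "divergence b x \<le> K + 2 * c x" for x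
      using K(2)[of x] c_nonneg[of x] by simp
    with K(1) show ?thesis by blast
  qed
  then obtain K where K: "0 \<le> K" "\<And>x. divergence b x \<le> K + 2 * c x" by blast

  have u_cont: "continuous_on UNIV u"
    using u_C2 by (auto simp: C_class_2_iff continuous_at_imp_continuous_on differentiable_imp_continuous_within)
  define E0 where "E0 = (\<integral>x. \<bar>u x\<bar> powr q \<partial>lebesgue)"
  have E0: "square_integral L (\<lambda>x. \<bar>u x\<bar> powr q) \<le> E0" for L
    unfolding E0_def
  proof (rule square_integral_le_lebesgue_integral)
    show "continuous_on UNIV (\<lambda>x. \<bar>u x\<bar> powr q)"
      by (intro continuous_on_powr' continuous_intros u_cont) (use q in auto)
    show "integrable lebesgue (\<lambda>x. \<bar>u x\<bar> powr q)"
      using u_Lq by (simp add: in_Lp_def)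
  qed simp
  define E where "E = E0 + 8 * ((552 * C + K) * E0 / lam)"
  have energy: "square_integral L (\<lambda>x. \<bar>u x\<bar> powr q + g'' (u x) * (norm (gradient u x))\<^sup>2) \<le> E"
    if "1 \<le> L" for L
    unfolding E_def
    by (rule energy_estimate[where g = "\<lambda>s. \<bar>s\<bar> powr q", OF a_C1 a_sym lam_pos a_elliptic b_C1
          C_ge(4) C1 C2 C3 c_nonneg K u_C2 u_solution g g' g''(1) _ g''(2) sg' E0 that]) simp

  \<comment> \<open>For a fixed point \<open>x\<close> the radius \<open>R\<close> is free, which is what forces \<open>u x = 0\<close> below.\<close>
  have decay: "\<bar>u x\<bar> powr q \<le> 2 * ((4 * E + 1) / R)" if R: "1 \<le> R" "norm x \<le> R" for x R
  proof -
    have abs_powr_nonneg: "0 \<le> \<bar>s\<bar> powr q" for s by simp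
    have "square_integral (2 * R) (\<lambda>x. \<bar>u x\<bar> powr q + g'' (u x) * (norm (gradient u x))\<^sup>2) \<le> E"
      by (rule energy) (use R in simp)
    from small_on_boundary_of_a_square[where g = "\<lambda>s. \<bar>s\<bar> powr q",
        OF u_C2 g g''(1) abs_powr_nonneg g''(2) g'_sq R(1) this]
    obtain r where r: "R \<le> r"
        "\<And>x. x \<in> frontier (cbox (vector [-r, -r]) (vector [r, r])) \<Longrightarrow> \<bar>u x\<bar> powr q \<le> 2 * ((4 * E + 1) / R)"
      by blast
    define m where "m = 2 * ((4 * E + 1) / R)"
    have "\<bar>u x\<bar> \<le> m powr (1 / q)"
    proof (rule maximum_principle_divergence_form[OF a_C1 a_sym lam_pos a_elliptic b_C1 c_nonneg u_C2 u_solution])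
      show "x \<in> cbox (vector [-r, -r]) (vector [r, r])"
        using R(2) r(1) component_le_norm_cart[of x 1] component_le_norm_cart[of x 2]
        by (auto simp: mem_box_cart forall_2 abs_le_iff)
      fix y :: "real^2" assume "y \<in> frontier (cbox (vector [-r, -r]) (vector [r, r]))"
      then have "\<bar>u y\<bar> powr q \<le> m" unfolding m_def by (rule r(2))
      then have "(\<bar>u y\<bar> powr q) powr (1 / q) \<le> m powr (1 / q)"
        using q by (intro powr_mono2) auto
      then show "\<bar>u y\<bar> \<le> m powr (1 / q)"
        using q by (simp add: powr_powr)
    qed (auto simp: compact_cbox)
    then have "\<bar>u x\<bar> powr q \<le> (m powr (1 / q)) powr q"
      using q by (intro powr_mono2) auto
    also have "\<dots> = \<bar>m\<bar>" using q by (simp add: powr_powr)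
    also have "\<dots> = m"
    proof -
      have "E0 \<ge> 0" by (simp add: E0_def)
      then have "0 \<le> E" using C_ge(4) K(1) lam_pos by (simp add: E_def)
      then show ?thesis using R by (simp add: m_def)
    qed
    finally show ?thesis by (simp add: m_def)
  qed
  show ?thesis
  proof
    fix x
    have "((\<lambda>R. 2 * ((4 * E + 1) / R)) \<longlongrightarrow> 0) at_top"
      by (intro tendsto_mult_right_zero tendsto_divide_0[OF tendsto_const] filterlim_at_top_imp_at_infinity filterlim_ident)
    moreover have "\<forall>\<^sub>F R in at_top. \<bar>u x\<bar> powr q \<le> 2 * ((4 * E + 1) / R)"
      using eventually_ge_at_top[of "max 1 (norm x)"] by eventually_elim (rule decay; simp)
    ultimately have "\<bar>u x\<bar> powr q \<le> 0"
      by (rule tendsto_lowerbound) simp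
    then show "u x = 0" by simp
  qed
qed

end
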